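(* Consider the twelve points of $\mathbb{R}^4$ $A=(27,-95,120,0)$, $B=(-50,-45,101,-94)$, $C=(-9,-67,126,-35)$, $D=(195,-145,11,125)$, $E=(-40,-10,8,-65)$, $F=(232,-102,-21,198)$, $G=(-63,-25,94,-139)$, $H=(-80,45,-49,-65)$, $I=(-72,4,24,-90)$, $J=(-30,167,-154,92)$, $K=(-43,190,-199,100)$, $L=(-67,80,-61,-26)$, and let $P=\operatorname{conv}\{A,B,C,D,E,F,G,H,I,J,K,L\}$. Then $P$ is a simplicial $4$-polytope with these twelve points as vertices, and each of the following $26$ four-element sets of vertices (written as words) is the vertex set of a facet of $P$: GHKL, DGHK, FGJK, EGHI, GJKL, DFGK, GHIL, DEGH, CDFG, ACDF, ACFJ, AFJK, ACJK, BCJK, BJKL, BDEG, ABDE, ABEI, AEHI, ABHI, BCHI, CHIL, ACDG, BCKL, ABDG, BCIL. Moreover, the simplicial complex generated by these $26$ facets is a non-separating Perles piece in the boundary complex of $P$; its facet-ridge graph (two of the $26$ sets are adjacent if and only if they have exactly three elements in common) is planar, and it is not the star of a vertex of the boundary complex of $P$.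
   Context: A $4$-polytope is simplicial if all of its facets are simplices; its boundary complex is then a pure $3$-dimensional simplicial complex, whose facets are the vertex sets of the facets of $P$ and whose ridges are the $3$-element faces. The facet-ridge graph of a pure simplicial complex has the facets as vertices, two facets being adjacent when they contain a common ridge. A boundary ridge of a pure $3$-dimensional simplicial complex is a ridge contained in only one facet of that complex. A Perles piece in a simplicial $3$-sphere $\Delta$ is a subcomplex generated by a set $\mathcal{F}$ of facets of $\Delta$ such that the facet-ridge graph of the subcomplex is connected and every facet in $\mathcal{F}$ contains exactly one boundary ridge of the subcomplex. It is non-separating if the graph obtained from the facet-ridge graph of $\Delta$ by deleting the vertices in $\mathcal{F}$ is connected. The star of a vertex $v$ in $\Delta$ is the subcomplex generated by all facets of $\Delta$ containing $v$. *)

theory Defs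
  imports "HOL-Analysis.Analysis" "Graph_Theory.Graph_Theory"
begin

text \<open>Simplicial complexes are represented by their sets of faces (finite vertex sets), the
  empty face included.\<close>

definition simplicial_complex :: "'a set set \<Rightarrow> bool" where
  "simplicial_complex \<Delta> \<longleftrightarrow>
     finite \<Delta> \<and> (\<forall>s\<in>\<Delta>. finite s) \<and> (\<forall>s\<in>\<Delta>. \<forall>t. t \<subseteq> s \<longrightarrow> t \<in> \<Delta>)"

definition generated_complex :: "'a set set \<Rightarrow> 'a set set" where
  "generated_complex \<F> = (\<Union>f\<in>\<F>. Pow f)"

definition complex_facets :: "'a set set \<Rightarrow> 'a set set" where
  "complex_facets \<Delta> = {s \<in> \<Delta>. \<forall>t\<in>\<Delta>. s \<subseteq> t \<longrightarrow> s = t}"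

definition star :: "'a set set \<Rightarrow> 'a \<Rightarrow> 'a set set" where
  "star \<Delta> v = generated_complex {f \<in> complex_facets \<Delta>. v \<in> f}"

text \<open>Geometric realization by barycentric coordinates, a subspace of the product space
  \<open>'a \<Rightarrow> real\<close>; on the realization of a finite complex this is the usual topology.\<close>

definition realization :: "'a set set \<Rightarrow> ('a \<Rightarrow> real) set" where
  "realization \<Delta> =
     {x. (\<forall>v. 0 \<le> x v) \<and> (\<exists>s\<in>\<Delta>. {v. x v \<noteq> 0} \<subseteq> s \<and> (\<Sum>v\<in>s. x v) = 1)}"

definition simplicial_3_sphere :: "'a set set \<Rightarrow> bool" where
  "simplicial_3_sphere \<Delta> \<longleftrightarrow>
     simplicial_complex \<Delta> \<and> realization \<Delta> homeomorphic sphere (0 :: real^4) 1"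

text \<open>The notions of ridge below are those for 3-dimensional complexes.\<close>

definition ridges :: "'a set set \<Rightarrow> 'a set set" where
  "ridges \<Delta> = {r \<in> \<Delta>. card r = 3}"

definition boundary_ridge :: "'a set set \<Rightarrow> 'a set \<Rightarrow> bool" where
  "boundary_ridge \<Delta> r \<longleftrightarrow> r \<in> ridges \<Delta> \<and> (\<exists>!f. f \<in> complex_facets \<Delta> \<and> r \<subseteq> f)"

text \<open>An undirected graph is encoded, as usual in the graph library, as a symmetric digraph.\<close>

definition facet_ridge_graph :: "'a set set \<Rightarrow> ('a set, 'a set \<times> 'a set) pre_digraph" where
  "facet_ridge_graph \<Delta> =
     \<lparr> verts = complex_facets \<Delta>,
       arcs = {(f, g). f \<in> complex_facets \<Delta> \<and> g \<in> complex_facets \<Delta> \<and> f \<noteq> g \<and>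
                       (\<exists>r\<in>ridges \<Delta>. r \<subseteq> f \<and> r \<subseteq> g)},
       tail = fst, head = snd \<rparr>"

text \<open>The set \<open>\<F>\<close> of generating facets is kept explicit, since separation refers to it.\<close>

definition generates_perles_piece :: "'a set set \<Rightarrow> 'a set set \<Rightarrow> bool" where
  "generates_perles_piece \<Delta> \<F> \<longleftrightarrow>
     simplicial_3_sphere \<Delta> \<and> \<F> \<subseteq> complex_facets \<Delta> \<and>
     Digraph_Component.connected (facet_ridge_graph (generated_complex \<F>)) \<and>
     (\<forall>f\<in>\<F>. \<exists>!r. boundary_ridge (generated_complex \<F>) r \<and> r \<subseteq> f)"

definition perles_piece :: "'a set set \<Rightarrow> 'a set set \<Rightarrow> bool" where
  "perles_piece \<Delta> \<Gamma> \<longleftrightarrow> (\<exists>\<F>. generates_perles_piece \<Delta> \<F> \<and> \<Gamma> = generated_complex \<F>)"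

definition non_separating_perles_piece :: "'a set set \<Rightarrow> 'a set set \<Rightarrow> bool" where
  "non_separating_perles_piece \<Delta> \<Gamma> \<longleftrightarrow>
     (\<exists>\<F>. generates_perles_piece \<Delta> \<F> \<and> \<Gamma> = generated_complex \<F> \<and>
       Digraph_Component.connected
         (facet_ridge_graph \<Delta> \<restriction> (verts (facet_ridge_graph \<Delta>) - \<F>)))"

text \<open>Planarity of a loopless graph: vertices are distinct points of the plane, edges are arcs
  joining their ends, avoiding all other vertices and meeting each other at most in common ends.
  An undirected edge is the set of its two ends, so opposite arcs share one curve.\<close>

definition undirected_edges :: "('v, 'e) pre_digraph \<Rightarrow> 'v set set" where
  "undirected_edges G = (\<lambda>(u, v). {u, v}) ` arcs_ends G"

definition planar_drawing ::
  "('v, 'e) pre_digraph \<Rightarrow> ('v \<Rightarrow> real^2) \<Rightarrow> ('v set \<Rightarrow> real \<Rightarrow> real^2) \<Rightarrow> bool" where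
  "planar_drawing G p \<gamma> \<longleftrightarrow>
     inj_on p (verts G) \<and>
     (\<forall>e\<in>undirected_edges G.
        arc (\<gamma> e) \<and> {pathstart (\<gamma> e), pathfinish (\<gamma> e)} = p ` e \<and>
        path_image (\<gamma> e) \<inter> p ` verts G = p ` e) \<and>
     (\<forall>e\<in>undirected_edges G. \<forall>e'\<in>undirected_edges G. e \<noteq> e' \<longrightarrow>
        path_image (\<gamma> e) \<inter> path_image (\<gamma> e') \<subseteq> p ` (e \<inter> e'))"

definition planar :: "('v, 'e) pre_digraph \<Rightarrow> bool" where
  "planar G \<longleftrightarrow> (\<exists>p \<gamma>. planar_drawing G p \<gamma>)"

definition polytope_vertices :: "'a::euclidean_space set \<Rightarrow> 'a set" where
  "polytope_vertices P = {v. v extreme_point_of P}"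

definition simplicial_polytope :: "int \<Rightarrow> 'a::euclidean_space set \<Rightarrow> bool" where
  "simplicial_polytope d P \<longleftrightarrow>
     polytope P \<and> aff_dim P = d \<and> (\<forall>F. F facet_of P \<longrightarrow> (\<exists>n. n simplex F))"

text \<open>The vertex sets of the proper faces, including the empty face; a simplicial complex if
  \<open>P\<close> is a simplicial polytope.\<close>

definition boundary_complex :: "'a::euclidean_space set \<Rightarrow> 'a set set" where
  "boundary_complex P = polytope_vertices ` {F. F face_of P \<and> F \<noteq> P}"

end

theory Submission
  imports Defs
begin

text \<open>Let \<open>\<W>\<close> be a family of exposed simplices on a finite set \<open>V\<close> such that each \<open>W \<in> \<W>\<close> and
  \<open>w \<in> W\<close> admit \<open>W' \<in> \<W>\<close> with \<open>w \<notin> W'\<close> and \<open>W - {w} \<subseteq> W'\<close>. Then \<open>\<W>\<close> consists of all facets of the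
  convex hull of \<open>V\<close>, by the argument that makes local optima global in the simplex algorithm:
  normalize the slack functionals \<open>h\<^sub>W\<close> to be 1 at the barycentre of \<open>V\<close>; if \<open>g \<ge> 0\<close> is a
  normalized supporting functional with \<open>g x = 0\<close>, choose \<open>W\<close> with \<open>h\<^sub>W x\<close> minimal. Then \<open>g - h\<^sub>W\<close>
  is a nonnegative combination of the differences \<open>h\<^sub>W\<^sub>' - h\<^sub>W\<close> over the neighbours \<open>W'\<close> of \<open>W\<close>, so
  \<open>h\<^sub>W x \<le> g x = 0\<close> and \<open>x\<close> lies on \<open>W\<close>. Hence 38 explicit inequalities determine the whole
  boundary complex of \<open>P\<close>, and what remains is finite: ridges, spanning orders for connectedness,
  and a straight-line drawing on the integer grid for planarity.\<close>

section \<open>Polytopes given by a closed system of facets\<close>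

text \<open>A hyperplane is affinely closed, so one that contains all other points but misses
  \<open>w\<close> keeps \<open>w\<close> out of their affine hull.\<close>

lemma affine_independentI_functional:
  fixes S :: "'a::real_inner set"
  assumes "\<And>w. w \<in> S \<Longrightarrow> \<exists>a b. a \<bullet> w \<noteq> b \<and> (\<forall>v\<in>S - {w}. a \<bullet> v = b)"
  shows "\<not> affine_dependent S"
proof
  assume "affine_dependent S"
  then obtain w where w: "w \<in> S" "w \<in> affine hull (S - {w})"
    by (auto simp: affine_dependent_def)
  obtain a b where ab: "a \<bullet> w \<noteq> b" "\<forall>v\<in>S - {w}. a \<bullet> v = b"
    using assms[OF w(1)] by blast
  have "affine hull (S - {w}) \<subseteq> {x. a \<bullet> x = b}"
    using ab(2) by (intro hull_minimal) (auto simp: affine_hyperplane)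
  with w(2) ab(1) show False by auto
qed

lemma polytope_vertices_simplex:
  "\<not> affine_dependent S \<Longrightarrow> polytope_vertices (convex hull S) = S"
  by (simp add: polytope_vertices_def extreme_point_of_convex_hull_affine_independent)

lemma barycenter_in_convex_hull:
  assumes "finite S" "S \<noteq> {}"
  shows "(\<Sum>v\<in>S. (1 / card S) *\<^sub>R v) \<in> convex hull S"
  using assms by (intro convex_sum) (auto intro: hull_inc)

text \<open>The slack at a barycentre is the mean of the slacks. Hence nonnegative slacks whose mean
  vanishes are all zero, and one positive slack makes the mean positive.\<close>

lemma inner_barycenter:
  assumes "finite S" "S \<noteq> {}"
  shows "b - a \<bullet> (\<Sum>v\<in>S. (1 / card S) *\<^sub>R v) = (\<Sum>v\<in>S. b - a \<bullet> v) / card S"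
  using assms by (simp add: inner_sum_right sum_subtractf diff_divide_distrib sum_divide_distrib)

lemma convex_hull_halfspace:
  fixes a :: "'a::real_inner"
  assumes "\<And>v. v \<in> V \<Longrightarrow> a \<bullet> v \<le> b" "x \<in> convex hull V"
  shows "a \<bullet> x \<le> b"
proof -
  have "convex hull V \<subseteq> {x. a \<bullet> x \<le> b}"
    using assms(1) by (intro hull_minimal) (auto simp: convex_halfspace_le)
  with assms(2) show ?thesis by auto
qed

lemma convex_hull_hyperplane:
  fixes a :: "'a::real_inner"
  assumes "\<And>v. v \<in> V \<Longrightarrow> a \<bullet> v = b" "x \<in> convex hull V"
  shows "a \<bullet> x = b"
proof -
  have "convex hull V \<subseteq> {x. a \<bullet> x = b}"
    using assms(1) by (intro hull_minimal) (auto simp: convex_hyperplane)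
  with assms(2) show ?thesis by auto
qed

text \<open>By \<open>opposite\<close>, each ridge of a member lies in a second member, so the
  generated complex has no boundary. Affine independence and full dimension are consequences, proved
  below.\<close>

locale closed_facet_system =
  fixes V :: "'a::euclidean_space set" and \<W> :: "'a set set"
  assumes finite_V: "finite V"
    and covers: "\<Union>\<W> = V"
    and nonempty: "\<W> \<noteq> {}"
    and card_W: "W \<in> \<W> \<Longrightarrow> card W = DIM('a)"
    and exposed: "W \<in> \<W> \<Longrightarrow> \<exists>a b. \<forall>v\<in>V. a \<bullet> v \<le> b \<and> (a \<bullet> v = b \<longleftrightarrow> v \<in> W)"
    and opposite: "W \<in> \<W> \<Longrightarrow> w \<in> W \<Longrightarrow> \<exists>W'\<in>\<W>. w \<notin> W' \<and> W - {w} \<subseteq> W'"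
begin

lemma W_subset: "W \<in> \<W> \<Longrightarrow> W \<subseteq> V"
  using covers by blast

lemma finite_W: "W \<in> \<W> \<Longrightarrow> finite W"
  using W_subset finite_V finite_subset by blast

lemma W_nonempty: "W \<in> \<W> \<Longrightarrow> W \<noteq> {}"
  using card_W by fastforce

lemma finite_family: "finite \<W>"
  using W_subset finite_V by (intro finite_subset[of \<W> "Pow V"]) auto

text \<open>The member opposite to a vertex is different but of the same size, so it has a point
  outside \<open>W\<close>.\<close>

lemma proper: assumes "W \<in> \<W>" shows "\<exists>v\<in>V. v \<notin> W"
proof -
  obtain w where w: "w \<in> W" using W_nonempty[OF assms] by blast
  obtain W' where W': "W' \<in> \<W>" "w \<notin> W'" using opposite[OF assms w] by blast
  have "\<not> W' \<subseteq> W"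
    using card_subset_eq[OF finite_W[OF assms], of W'] card_W[OF assms] card_W[OF W'(1)] W'(2) w
    by auto
  then show ?thesis using W_subset[OF W'(1)] by blast
qed

section \<open>Slack functionals normalized at the barycentre\<close>

definition centre :: 'a where
  "centre = (\<Sum>v\<in>V. (1 / card V) *\<^sub>R v)"

lemma V_nonempty: "V \<noteq> {}"
  using nonempty W_nonempty W_subset by blast

lemma centre_in_hull: "centre \<in> convex hull V"
  unfolding centre_def by (rule barycenter_in_convex_hull[OF finite_V V_nonempty])

text \<open>Some point lies strictly below the hyperplane of \<open>W\<close>, so the mean slack,
  which is the slack at \<open>centre\<close>, is positive and can be scaled to 1.\<close>

lemma slack_functionals:
  obtains a :: "'a set \<Rightarrow> 'a" and b :: "'a set \<Rightarrow> real"
  where "\<And>W v. W \<in> \<W> \<Longrightarrow> v \<in> V \<Longrightarrow> a W \<bullet> v \<le> b W"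
    and "\<And>W v. W \<in> \<W> \<Longrightarrow> v \<in> V \<Longrightarrow> a W \<bullet> v = b W \<longleftrightarrow> v \<in> W"
    and "\<And>W. W \<in> \<W> \<Longrightarrow> b W - a W \<bullet> centre = 1"
proof -
  obtain a0 b0 where ab: "\<And>W v. W \<in> \<W> \<Longrightarrow> v \<in> V \<Longrightarrow> a0 W \<bullet> v \<le> b0 W"
    "\<And>W v. W \<in> \<W> \<Longrightarrow> v \<in> V \<Longrightarrow> a0 W \<bullet> v = b0 W \<longleftrightarrow> v \<in> W"
    using exposed by metis
  define s where "s W = b0 W - a0 W \<bullet> centre" for W
  have s: "s W > 0" if W: "W \<in> \<W>" for W
  proof -
    obtain u where u: "u \<in> V" "u \<notin> W" using proper[OF W] by blast
    have "0 < (\<Sum>v\<in>V. b0 W - a0 W \<bullet> v)"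
      using ab(1)[OF W] ab(1,2)[OF W u(1)] u
      by (intro sum_pos2[OF finite_V u(1)]) force+
    then show ?thesis
      using finite_V V_nonempty
      by (simp add: s_def centre_def inner_barycenter card_gt_0_iff)
  qed
  show ?thesis
  proof (rule that[of "\<lambda>W. a0 W /\<^sub>R s W" "\<lambda>W. b0 W / s W"])
    fix W v assume W: "W \<in> \<W>" and v: "v \<in> V"
    show "(a0 W /\<^sub>R s W) \<bullet> v \<le> b0 W / s W"
      using ab(1)[OF W v] s[OF W] by (simp add: field_simps)
    show "(a0 W /\<^sub>R s W) \<bullet> v = b0 W / s W \<longleftrightarrow> v \<in> W"
      using ab(2)[OF W v] s[OF W] by (simp add: field_simps)
  next
    fix W assume W: "W \<in> \<W>"
    have "b0 W / s W - (a0 W /\<^sub>R s W) \<bullet> centre = s W / s W"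
      by (simp add: s_def field_simps diff_divide_distrib)
    then show "b0 W / s W - (a0 W /\<^sub>R s W) \<bullet> centre = 1"
      using s[OF W] by simp
  qed
qed

text \<open>The functional separating \<open>w \<in> W\<close> from the rest of \<open>insert centre W\<close> is the difference of the
  slacks of \<open>W\<close> and of the member opposite to \<open>w\<close>.\<close>

lemma independent_insert_centre:
  assumes W: "W \<in> \<W>"
  shows "\<not> affine_dependent (insert centre W)" and "centre \<notin> W"
proof -
  obtain a b where le: "\<And>W v. W \<in> \<W> \<Longrightarrow> v \<in> V \<Longrightarrow> a W \<bullet> v \<le> b W"
    and eq: "\<And>W v. W \<in> \<W> \<Longrightarrow> v \<in> V \<Longrightarrow> a W \<bullet> v = b W \<longleftrightarrow> v \<in> W"
    and c: "\<And>W. W \<in> \<W> \<Longrightarrow> b W - a W \<bullet> centre = 1"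
    by (rule slack_functionals) blast
  show nin: "centre \<notin> W"
    using c[OF W] eq[OF W] W_subset[OF W] by fastforce
  show "\<not> affine_dependent (insert centre W)"
  proof (rule affine_independentI_functional)
    fix w assume w: "w \<in> insert centre W"
    show "\<exists>a b. a \<bullet> w \<noteq> b \<and> (\<forall>v\<in>insert centre W - {w}. a \<bullet> v = b)"
    proof (cases "w = centre")
      case True
      \<comment> \<open>The slack of \<open>W\<close> alone separates here: it vanishes on
        \<open>W\<close> and is 1 at \<open>centre\<close>.\<close>
      then show ?thesis
        using c[OF W] eq[OF W] W_subset[OF W]
        by (intro exI[of _ "a W"] exI[of _ "b W"]) auto
    next
      case False
      with w have w: "w \<in> W" by auto
      obtain W' where W': "W' \<in> \<W>" "w \<notin> W'" "W - {w} \<subseteq> W'"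
        using opposite[OF W w] by blast
      have wV: "w \<in> V" using W_subset[OF W] w by blast
      have "b W' - a W' \<bullet> w \<noteq> 0" "b W - a W \<bullet> w = 0"
        using eq[OF W'(1) wV] eq[OF W wV] W'(2) w by auto
      moreover have "b W' - a W' \<bullet> v = b W - a W \<bullet> v" if v: "v \<in> insert centre W - {w}" for v
      proof (cases "v = centre")
        case True then show ?thesis using c[OF W] c[OF W'(1)] by simp
      next
        case False
        with v have "v \<in> W" "v \<in> W'" "v \<in> V" using W'(3) W_subset[OF W] by auto
        then show ?thesis using eq[OF W, of v] eq[OF W'(1), of v] by simp
      qed
      ultimately show ?thesis
        by (intro exI[of _ "a W' - a W"] exI[of _ "b W' - b W"])
          (fastforce simp: inner_diff_left algebra_simps)
    qed
  qed
qed

lemma independent: "W \<in> \<W> \<Longrightarrow> \<not> affine_dependent W"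
  using independent_insert_centre(1) affine_independent_subset by blast

text \<open>These are \<open>DIM('a) + 1\<close> independent points, hence an affine basis: an
  affine function vanishing on them vanishes everywhere.\<close>

lemma affine_hull_insert_centre:
  assumes "W \<in> \<W>" shows "affine hull (insert centre W) = UNIV"
  using independent_insert_centre[OF assms] finite_W[OF assms] card_W[OF assms]
  by (intro affine_independent_span_eq) auto

section \<open>The faces of the hull\<close>

text \<open>The passage from local to global: \<open>opposite\<close> speaks only of neighbours of
  one member, yet it forces every tight point of an arbitrary supporting functional onto a
  hyperplane of the family.\<close>

lemma supporting_point_on_facet:
  assumes supp: "\<And>v. v \<in> V \<Longrightarrow> c \<bullet> v \<le> d" "c \<bullet> centre < d"
    and x: "x \<in> convex hull V" "c \<bullet> x = d"
  obtains W a b where "W \<in> \<W>" "\<And>v. v \<in> V \<Longrightarrow> a \<bullet> v \<le> b"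
    "\<And>v. v \<in> V \<Longrightarrow> a \<bullet> v = b \<longleftrightarrow> v \<in> W" "a \<bullet> x = b"
proof -
  obtain a b where le: "\<And>W v. W \<in> \<W> \<Longrightarrow> v \<in> V \<Longrightarrow> a W \<bullet> v \<le> b W"
    and eq: "\<And>W v. W \<in> \<W> \<Longrightarrow> v \<in> V \<Longrightarrow> a W \<bullet> v = b W \<longleftrightarrow> v \<in> W"
    and c: "\<And>W. W \<in> \<W> \<Longrightarrow> b W - a W \<bullet> centre = 1"
    by (rule slack_functionals) blast
  define h where "h W y = b W - a W \<bullet> y" for W y
  define s where "s = d - c \<bullet> centre"
  define g where "g y = (d - c \<bullet> y) / s" for y
  have s: "s > 0" using supp(2) by (simp add: s_def)
  obtain W where W: "W \<in> \<W>" and min: "\<And>W'. W' \<in> \<W> \<Longrightarrow> h W x \<le> h W' x"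
  proof -
    obtain W where "is_arg_min (\<lambda>W. h W x) (\<lambda>W. W \<in> \<W>) W"
      using ex_is_arg_min_if_finite[OF finite_family nonempty] by blast
    then show ?thesis using that by (force simp: is_arg_min_linorder)
  qed
  obtain N where N: "\<And>w. w \<in> W \<Longrightarrow> N w \<in> \<W>" "\<And>w. w \<in> W \<Longrightarrow> w \<notin> N w"
    "\<And>w. w \<in> W \<Longrightarrow> W - {w} \<subseteq> N w"
    using opposite[OF W] by metis
  have WV: "w \<in> V" if "w \<in> W" for w using W_subset[OF W] that by blast
  \<comment> \<open>At \<open>w\<close> only the difference belonging to \<open>N w\<close> is
    nonzero, because \<open>w\<close> lies in \<open>W\<close> and in \<open>N w'\<close> for each
    other \<open>w'\<close> in \<open>W\<close>. This determines the coefficient.\<close>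
  define t where "t w = g w / h (N w) w" for w
  have hN: "h (N w) w > 0" if "w \<in> W" for w
    using le[OF N(1)[OF that] WV[OF that]] eq[OF N(1)[OF that] WV[OF that]] N(2)[OF that]
    by (simp add: h_def)
  have t: "t w \<ge> 0" if "w \<in> W" for w
    using supp(1)[OF WV[OF that]] s hN[OF that] by (simp add: t_def g_def)
  define D where "D y = g y - h W y - (\<Sum>w\<in>W. t w * (h (N w) y - h W y))" for y
  \<comment> \<open>\<open>D\<close> is affine and vanishes on the affine basis \<open>insert centre W\<close>.\<close>
  have D0: "D y = 0" for y
  proof -
    define d' where "d' = d / s - b W - (\<Sum>w\<in>W. t w * (b (N w) - b W))"
    define c' where "c' = c /\<^sub>R s - a W - (\<Sum>w\<in>W. t w *\<^sub>R (a (N w) - a W))"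
    have D: "D y = d' - c' \<bullet> y" for y
      by (simp add: D_def g_def h_def d'_def c'_def inner_diff_left inner_sum_left
          divide_inverse algebra_simps sum_subtractf sum.distrib)
    \<comment> \<open>The normalization enters here: \<open>g\<close> and all slacks of members
      equal 1 at \<open>centre\<close>.\<close>
    have "D centre = 0"
      using s c W N(1) by (simp add: D_def g_def h_def s_def)
    moreover have "D v = 0" if v: "v \<in> W" for v
    proof -
      have hW: "h W v = 0" using eq[OF W WV[OF v]] v by (simp add: h_def)
      have "(\<Sum>w\<in>W. t w * (h (N w) v - h W v)) = (\<Sum>w\<in>{v}. t w * h (N w) v)"
      proof (intro sum.mono_neutral_cong_right)
        show "\<forall>w\<in>W - {v}. t w * (h (N w) v - h W v) = 0"
        proof
          fix w assume w: "w \<in> W - {v}"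
          then have "v \<in> N w" using N(3)[of w] v by blast
          then show "t w * (h (N w) v - h W v) = 0"
            using eq[OF N(1), of w v] WV[OF v] w hW by (auto simp: h_def)
        qed
      qed (use v finite_W[OF W] hW in auto)
      then show ?thesis using hN[OF v] hW by (simp add: D_def t_def)
    qed
    ultimately have "affine hull (insert centre W) \<subseteq> {y. c' \<bullet> y = d'}"
      by (intro hull_minimal) (auto simp: affine_hyperplane D)
    then have "y \<in> {y. c' \<bullet> y = d'}" using affine_hull_insert_centre[OF W] by blast
    then show ?thesis using D[of y] by simp
  qed
  \<comment> \<open>Minimality of \<open>h W x\<close> makes each difference nonnegative at
    \<open>x\<close>; since \<open>D x = 0\<close> and \<open>g x = 0\<close>, the slack of
    \<open>W\<close> at \<open>x\<close> is at most 0.\<close>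
  have "(\<Sum>w\<in>W. t w * (h (N w) x - h W x)) \<ge> 0"
    using t min N(1) by (intro sum_nonneg) auto
  with D0[of x] x(2) have "h W x \<le> 0" by (simp add: D_def g_def)
  moreover have "h W x \<ge> 0"
    using convex_hull_halfspace[of V "a W" "b W" x] le[OF W] x(1) by (simp add: h_def)
  ultimately have "a W \<bullet> x = b W" by (simp add: h_def)
  then show ?thesis using that[of W "a W" "b W"] W le eq by blast
qed

text \<open>Let \<open>T\<close> be a set of points of \<open>V\<close> spanning the face. A member
  whose hyperplane passes through the barycentre of \<open>T\<close> is tight on all of
  \<open>T\<close>, so a single application of the preceding lemma captures the whole face.\<close>

lemma proper_face_simplex:
  assumes Q: "Q face_of (convex hull V)" "Q \<noteq> convex hull V"
  obtains W T where "W \<in> \<W>" "T \<subseteq> W" "Q = convex hull T"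
proof (cases "Q = {}")
  case True
  obtain W where "W \<in> \<W>" using nonempty by blast
  with True show ?thesis using that[of W "{}"] by simp
next
  case False
  let ?P = "convex hull V"
  have poly: "polyhedron ?P"
    by (simp add: finite_V polytope_convex_hull polytope_imp_polyhedron)
  obtain c d where cd: "?P \<subseteq> {x. c \<bullet> x \<le> d}" "Q = ?P \<inter> {x. c \<bullet> x = d}"
    using Q(1) poly exposed_face_of_polyhedron exposed_face_of_def by metis
  obtain T where T: "T \<subseteq> V" "Q = convex hull T"
    using face_of_convex_hull_subset[OF finite_imp_compact[OF finite_V] Q(1)] by blast
  have Tne: "T \<noteq> {}" "finite T" using False T finite_V finite_subset by auto
  have le: "c \<bullet> v \<le> d" if "v \<in> V" for v using cd(1) hull_inc[OF that] by blast
  have eqT: "c \<bullet> v = d" if "v \<in> T" for v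
    using cd(2) T(2) hull_inc[OF that] by blast
  \<comment> \<open>If the hyperplane passed through \<open>centre\<close>, the mean slack and so
    every slack would vanish, and \<open>Q\<close> would be the whole hull.\<close>
  have lt: "c \<bullet> centre < d"
  proof (rule ccontr)
    assume "\<not> c \<bullet> centre < d"
    then have "d - c \<bullet> centre \<le> 0" by simp
    then have "(\<Sum>v\<in>V. d - c \<bullet> v) \<le> 0"
      using finite_V V_nonempty
      by (simp add: centre_def inner_barycenter divide_le_0_iff card_eq_0_iff)
    moreover have "(\<Sum>v\<in>V. d - c \<bullet> v) \<ge> 0" using le by (intro sum_nonneg) auto
    ultimately have "(\<Sum>v\<in>V. d - c \<bullet> v) = 0" by simp
    then have "\<forall>v\<in>V. d - c \<bullet> v = 0"
      using le finite_V by (subst (asm) sum_nonneg_eq_0_iff) auto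
    then have "c \<bullet> x = d" if "x \<in> ?P" for x
      using that convex_hull_hyperplane[of V c d x] by auto
    with cd(2) Q(2) show False by auto
  qed
  define x where "x = (\<Sum>v\<in>T. (1 / card T) *\<^sub>R v)"
  have xT: "x \<in> convex hull T" unfolding x_def using Tne by (intro barycenter_in_convex_hull)
  have xV: "x \<in> ?P" using xT hull_mono[OF T(1)] by blast
  have xd: "c \<bullet> x = d" using xT eqT convex_hull_hyperplane by blast
  obtain W a b where W: "W \<in> \<W>" "\<And>v. v \<in> V \<Longrightarrow> a \<bullet> v \<le> b"
    "\<And>v. v \<in> V \<Longrightarrow> a \<bullet> v = b \<longleftrightarrow> v \<in> W" "a \<bullet> x = b"
    using supporting_point_on_facet[OF le lt xV xd] by metis
  have "(\<Sum>v\<in>T. b - a \<bullet> v) / card T = 0"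
    using inner_barycenter[OF Tne(2,1), of b a] W(4) by (simp add: x_def)
  then have "(\<Sum>v\<in>T. b - a \<bullet> v) = 0" using Tne by simp
  then have "\<forall>v\<in>T. b - a \<bullet> v = 0"
    using W(2) T(1) Tne by (subst (asm) sum_nonneg_eq_0_iff) auto
  then have "T \<subseteq> W" using W(3) T(1) by fastforce
  then show ?thesis using that W(1) T(2) by blast
qed

text \<open>The supporting hyperplane of \<open>W\<close> cuts out exactly the hull of
  \<open>W\<close>; this is a simplex, whose faces are the hulls of its subsets, and faces of faces
  are faces.\<close>

lemma simplex_face:
  assumes W: "W \<in> \<W>" and "T \<subseteq> W"
  shows "convex hull T face_of convex hull V" and "convex hull T \<noteq> convex hull V"
proof -
  obtain a b where ab: "\<And>v. v \<in> V \<Longrightarrow> a \<bullet> v \<le> b" "\<And>v. v \<in> V \<Longrightarrow> a \<bullet> v = b \<longleftrightarrow> v \<in> W"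
    using exposed[OF W] by blast
  let ?P = "convex hull V"
  let ?Q = "?P \<inter> {x. a \<bullet> x = b}"
  have Qf: "?Q face_of ?P"
    using convex_hull_halfspace[OF ab(1)] by (intro face_of_Int_supporting_hyperplane_le) auto
  obtain S where S: "S \<subseteq> V" "?Q = convex hull S"
    using face_of_convex_hull_subset[OF finite_imp_compact[OF finite_V] Qf] by blast
  \<comment> \<open>The points of \<open>S\<close> are points of \<open>V\<close> on the hyperplane,
    and by exposedness these are in \<open>W\<close>.\<close>
  have "S \<subseteq> W" using S ab(2) hull_inc[of _ S convex] by blast
  then have "?Q \<subseteq> convex hull W" using S(2) hull_mono by metis
  moreover have "convex hull W \<subseteq> ?Q"
    using hull_mono[OF W_subset[OF W]] convex_hull_hyperplane[of W a b] ab(2) W_subset[OF W] by blast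
  ultimately have "convex hull W face_of ?P" and WQ: "convex hull W = ?Q" using Qf by auto
  moreover have "convex hull T face_of convex hull W"
    using face_of_convex_hull_affine_independent[OF independent[OF W]] assms(2) by blast
  ultimately show "convex hull T face_of ?P" using face_of_trans by blast
  obtain v where v: "v \<in> V" "v \<notin> W" using proper[OF W] by blast
  then have "v \<notin> convex hull W" using WQ ab(2) by auto
  then show "convex hull T \<noteq> ?P"
    using hull_inc[OF v(1), of convex] hull_mono[OF assms(2), of convex] by blast
qed

lemma vertices_subset: "W \<in> \<W> \<Longrightarrow> T \<subseteq> W \<Longrightarrow> polytope_vertices (convex hull T) = T"
  using independent affine_independent_subset polytope_vertices_simplex by blast

lemma boundary_complex_eq: "boundary_complex (convex hull V) = generated_complex \<W>"
proof
  show "boundary_complex (convex hull V) \<subseteq> generated_complex \<W>"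
    unfolding boundary_complex_def generated_complex_def
    by (auto elim!: proper_face_simplex simp: vertices_subset)
  show "generated_complex \<W> \<subseteq> boundary_complex (convex hull V)"
  proof
    fix T assume "T \<in> generated_complex \<W>"
    then obtain W where W: "W \<in> \<W>" "T \<subseteq> W" by (auto simp: generated_complex_def)
    then show "T \<in> boundary_complex (convex hull V)"
      unfolding boundary_complex_def using simplex_face[OF W] vertices_subset[OF W]
      by (intro image_eqI[of _ _ "convex hull T"]) auto
  qed
qed

lemma vertices_hull: "polytope_vertices (convex hull V) = V"
proof
  show "polytope_vertices (convex hull V) \<subseteq> V"
    using extreme_point_of_convex_hull by (auto simp: polytope_vertices_def)
  show "V \<subseteq> polytope_vertices (convex hull V)"
  proof
    fix v assume "v \<in> V"
    then obtain W where "W \<in> \<W>" "{v} \<subseteq> W" using covers by blast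
    from simplex_face(1)[OF this] show "v \<in> polytope_vertices (convex hull V)"
      by (simp add: polytope_vertices_def face_of_singleton)
  qed
qed

lemma aff_dim_hull: "aff_dim (convex hull V) = DIM('a)"
proof -
  obtain W where W: "W \<in> \<W>" using nonempty by blast
  have "insert centre W \<subseteq> convex hull V"
    using centre_in_hull W_subset[OF W] hull_subset[of V convex] by blast
  then have "affine hull (insert centre W) \<subseteq> affine hull (convex hull V)" by (rule hull_mono)
  then have "affine hull (convex hull V) = UNIV" using affine_hull_insert_centre[OF W] by auto
  then show ?thesis using aff_dim_eq_full by blast
qed

lemma facet:
  assumes "W \<in> \<W>"
  shows "convex hull W facet_of convex hull V"
proof -
  have "aff_dim (convex hull W) = int (card W) - 1"
    using aff_dim_affine_independent[OF independent[OF assms]] by (simp add: aff_dim_convex_hull)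
  then show ?thesis
    using simplex_face(1)[OF assms order_refl] aff_dim_hull card_W[OF assms] W_nonempty[OF assms]
    by (simp add: facet_of_def)
qed

lemma simplicial: "simplicial_polytope DIM('a) (convex hull V)"
  unfolding simplicial_polytope_def
proof (intro conjI allI impI)
  show "polytope (convex hull V)" by (simp add: finite_V polytope_convex_hull)
  show "aff_dim (convex hull V) = DIM('a)" by (rule aff_dim_hull)
next
  fix Q assume "Q facet_of convex hull V"
  then have "Q face_of convex hull V" "Q \<noteq> convex hull V"
    by (auto simp: facet_of_def)
  then obtain W T where "W \<in> \<W>" "T \<subseteq> W" "Q = convex hull T"
    by (rule proper_face_simplex)
  then show "\<exists>n. n simplex Q"
    using independent[of W] affine_independent_subset[of W T]
      simplex_convex_hull[of T "int (card T) - 1"] by auto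
qed

text \<open>The frontier of a polyhedron is the union of its proper faces, each of which lies in the
  simplex on a member. This is the image of the realization under the map used below.\<close>

lemma rel_frontier_hull: "rel_frontier (convex hull V) = (\<Union>W\<in>\<W>. convex hull W)"
proof -
  have "rel_frontier (convex hull V)
      = \<Union>{Q. Q face_of convex hull V \<and> Q \<noteq> convex hull V}"
    by (intro rel_frontier_of_polyhedron_alt)
      (simp add: finite_V polytope_convex_hull polytope_imp_polyhedron)
  also have "\<dots> = (\<Union>W\<in>\<W>. convex hull W)"
  proof
    show "\<Union>{Q. Q face_of convex hull V \<and> Q \<noteq> convex hull V} \<subseteq> (\<Union>W\<in>\<W>. convex hull W)"
    proof
      fix x assume "x \<in> \<Union>{Q. Q face_of convex hull V \<and> Q \<noteq> convex hull V}"
      then obtain Q where Q: "Q face_of convex hull V" "Q \<noteq> convex hull V" "x \<in> Q" by blast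
      obtain W T where "W \<in> \<W>" "T \<subseteq> W" "Q = convex hull T"
        using proper_face_simplex[OF Q(1,2)] by blast
      then show "x \<in> (\<Union>W\<in>\<W>. convex hull W)" using Q(3) hull_mono[of T W convex] by blast
    qed
    show "(\<Union>W\<in>\<W>. convex hull W) \<subseteq> \<Union>{Q. Q face_of convex hull V \<and> Q \<noteq> convex hull V}"
      using simplex_face[OF _ order_refl] by (intro UN_least Union_upper) auto
  qed
  finally show ?thesis .
qed

section \<open>The realization is a sphere\<close>

text \<open>Coordinates supported on a face are also supported on any member containing it, so the
  realization is a finite union of full simplices, each described by closed conditions.\<close>

lemma realization_eq:
  "realization (generated_complex \<W>)
     = (\<Union>W\<in>\<W>. {x. (\<forall>v. 0 \<le> x v) \<and> (\<forall>v. v \<notin> W \<longrightarrow> x v = 0) \<and> (\<Sum>v\<in>W. x v) = 1})" (is "?l = ?r")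
proof
  show "?l \<subseteq> ?r"
  proof
    fix x assume "x \<in> ?l"
    then obtain s W where x: "\<forall>v. 0 \<le> x v" "W \<in> \<W>" "s \<subseteq> W" "{v. x v \<noteq> 0} \<subseteq> s" "(\<Sum>v\<in>s. x v) = 1"
      by (auto simp: realization_def generated_complex_def)
    have "(\<Sum>v\<in>W. x v) = (\<Sum>v\<in>s. x v)"
      using x finite_W by (intro sum.mono_neutral_right) auto
    with x show "x \<in> ?r" by (intro UN_I[of W]) auto
  qed
  show "?r \<subseteq> ?l"
  proof
    fix x assume "x \<in> ?r"
    then obtain W where "W \<in> \<W>" "\<forall>v. 0 \<le> x v" "\<forall>v. v \<notin> W \<longrightarrow> x v = 0" "(\<Sum>v\<in>W. x v) = 1" by blast
    then show "x \<in> ?l"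
      unfolding realization_def generated_complex_def by (intro CollectI conjI bexI[of _ W]) auto
  qed
qed

lemma compact_realization: "compact (realization (generated_complex \<W>))"
proof -
  have "compact {x. (\<forall>v. 0 \<le> x v) \<and> (\<forall>v. v \<notin> W \<longrightarrow> x v = 0) \<and> (\<Sum>v\<in>W. x v) = (1::real)}"
    (is "compact ?K") if W: "W \<in> \<W>" for W
  proof -
    \<comment> \<open>The index type is infinite, so compactness comes from Tychonoff, with the
      one-point factor \<open>{0}\<close> at every index off \<open>W\<close>.\<close>
    let ?B = "PiE UNIV (\<lambda>v. if v \<in> W then {0..1} else {0::real})"
    have "compactin (product_topology (\<lambda>_. euclidean) UNIV) ?B"
      by (subst compactin_PiE) auto
    then have "compact ?B" by (simp add: euclidean_product_topology)
    moreover have "closed {x. (\<Sum>v\<in>W. x v) = (1::real)}"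
      by (intro closed_Collect_eq continuous_intros) simp_all
    moreover have "?K = ?B \<inter> {x. (\<Sum>v\<in>W. x v) = (1::real)}"
    proof -
      have "x v \<le> 1" if "\<forall>v. 0 \<le> x v" "(\<Sum>v\<in>W. x v) = 1" "v \<in> W" for x :: "'a \<Rightarrow> real" and v
        using that member_le_sum[of v W x] finite_W[OF W] by auto
      then show ?thesis by (fastforce simp: PiE_iff split: if_splits)
    qed
    ultimately show ?thesis by (simp add: compact_Int_closed)
  qed
  then show ?thesis unfolding realization_eq using finite_family by (intro compact_UN) auto
qed

text \<open>Reading barycentric coordinates as convex combinations is a continuous bijection from a
  compact space onto the frontier of the hull, hence a homeomorphism.\<close>

lemma realization_homeomorphic_sphere:
  "realization (generated_complex \<W>) homeomorphic sphere (0::'a) 1"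
proof -
  let ?R = "realization (generated_complex \<W>)"
  define \<phi> where "\<phi> x = (\<Sum>v\<in>V. x v *\<^sub>R v)" for x :: "'a \<Rightarrow> real"
  have sub: "\<phi> x = (\<Sum>v\<in>W. x v *\<^sub>R v)" if "W \<in> \<W>" "\<forall>v. v \<notin> W \<longrightarrow> x v = 0" for x W
    unfolding \<phi>_def using that(2) finite_V W_subset[OF that(1)]
    by (intro sum.mono_neutral_right) auto
  have "?R homeomorphic rel_frontier (convex hull V)"
  proof (rule homeomorphic_compact[of _ \<phi>])
    show "compact ?R" by (rule compact_realization)
    show "continuous_on ?R \<phi>"
      unfolding \<phi>_def
      by (intro continuous_on_sum continuous_on_scaleR continuous_on_const
          continuous_on_subset[OF continuous_on_product_coordinates] subset_UNIV)
    show "\<phi> ` ?R = rel_frontier (convex hull V)"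
    proof
      show "\<phi> ` ?R \<subseteq> rel_frontier (convex hull V)"
        unfolding rel_frontier_hull realization_eq
      proof clarify
        fix x :: "'a \<Rightarrow> real" and W assume "W \<in> \<W>" "\<forall>v. 0 \<le> x v" "\<forall>v. v \<notin> W \<longrightarrow> x v = 0" "sum x W = 1"
        then show "\<phi> x \<in> (\<Union>W\<in>\<W>. convex hull W)"
          using sub[of W x] by (intro UN_I[of W]) (auto simp: convex_hull_finite[OF finite_W])
      qed
      show "rel_frontier (convex hull V) \<subseteq> \<phi> ` ?R"
      proof
        fix p assume "p \<in> rel_frontier (convex hull V)"
        then obtain W u where W: "W \<in> \<W>" and u: "\<forall>x\<in>W. 0 \<le> u x" "sum u W = 1" "(\<Sum>x\<in>W. u x *\<^sub>R x) = p"
          unfolding rel_frontier_hull using convex_hull_finite[OF finite_W] by (force elim!: UN_E)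
        define x where "x v = (if v \<in> W then u v else 0)" for v
        have "x \<in> ?R" unfolding realization_eq using W u by (intro UN_I[of W]) (auto simp: x_def)
        moreover have "\<phi> x = p" using sub[OF W, of x] u(3) by (simp add: x_def)
        ultimately show "p \<in> \<phi> ` ?R" by blast
      qed
    qed
    show "inj_on \<phi> ?R"
    proof (rule inj_onI)
      fix x y assume "x \<in> ?R" "y \<in> ?R" and eq: "\<phi> x = \<phi> y"
      then obtain W W' where W: "W \<in> \<W>" and x: "\<forall>v. 0 \<le> x v" "\<forall>v. v \<notin> W \<longrightarrow> x v = 0" "(\<Sum>v\<in>W. x v) = 1"
        and W': "W' \<in> \<W>" and y: "\<forall>v. 0 \<le> y v" "\<forall>v. v \<notin> W' \<longrightarrow> y v = 0" "(\<Sum>v\<in>W'. y v) = 1"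
        unfolding realization_eq by auto
      \<comment> \<open>The slack of \<open>W\<close> vanishes at the common image, so
        \<open>y\<close> is also supported on \<open>W\<close>. Then both points have coordinates on
        one independent set, where these are unique.\<close>
      obtain a b where ab: "\<And>v. v \<in> V \<Longrightarrow> a \<bullet> v \<le> b" "\<And>v. v \<in> V \<Longrightarrow> a \<bullet> v = b \<longleftrightarrow> v \<in> W"
        using exposed[OF W] by blast
      have V1: "(\<Sum>v\<in>V. x v) = 1" "(\<Sum>v\<in>V. y v) = 1"
        using x(2,3) y(2,3) sum.mono_neutral_right[OF finite_V W_subset[OF W], of x]
          sum.mono_neutral_right[OF finite_V W_subset[OF W'], of y] by auto
      have slack: "(\<Sum>v\<in>V. z v * (b - a \<bullet> v)) = b - a \<bullet> \<phi> z" if "(\<Sum>v\<in>V. z v) = 1" for z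
        using that by (simp add: \<phi>_def inner_sum_right right_diff_distrib sum_subtractf flip: sum_distrib_right)
      have "(\<Sum>v\<in>V. x v * (b - a \<bullet> v)) = 0"
        using ab(2) x(2) by (intro sum.neutral) auto
      then have "(\<Sum>v\<in>V. y v * (b - a \<bullet> v)) = 0" using slack V1 eq by simp
      then have "\<forall>v\<in>V. y v * (b - a \<bullet> v) = 0"
        using ab(1) y(1) finite_V by (subst (asm) sum_nonneg_eq_0_iff) auto
      then have yW: "\<forall>v. v \<notin> W \<longrightarrow> y v = 0"
        using ab(2) y(2) W_subset[OF W'] by (metis eq_iff_diff_eq_0 mult_eq_0_iff subsetD)
      have yW1: "(\<Sum>v\<in>W. y v) = 1"
        using V1(2) yW sum.mono_neutral_right[OF finite_V W_subset[OF W], of y] by auto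
      have "(\<Sum>v\<in>W. (x v - y v) *\<^sub>R v) = 0"
        using eq sub[OF W x(2)] sub[OF W yW] by (simp add: scaleR_left_diff_distrib sum_subtractf)
      moreover have "(\<Sum>v\<in>W. x v - y v) = 0" using x(3) yW1 by (simp add: sum_subtractf)
      ultimately have "\<forall>v\<in>W. x v - y v = 0"
        using independent[OF W] unfolding affine_dependent_explicit_finite[OF finite_W[OF W]] by blast
      then show "x = y" using x(2) yW by (metis eq_iff_diff_eq_0 ext)
    qed
  qed
  \<comment> \<open>Bounded convex sets of equal affine dimension have homeomorphic relative
    frontiers; both sets here have full dimension.\<close>
  also have "rel_frontier (convex hull V) homeomorphic rel_frontier (cball (0::'a) 1)"
    using aff_dim_hull finite_V
    by (intro homeomorphic_rel_frontiers_convex_bounded_sets)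
      (auto simp: finite_imp_bounded bounded_convex_hull aff_dim_cball)
  also have "rel_frontier (cball (0::'a) 1) = sphere 0 1"
    by (auto simp: rel_frontier_def rel_interior_nonempty_interior)
  finally show ?thesis .
qed

end

section \<open>Pure three-dimensional complexes\<close>

text \<open>Sets of equal finite size form an antichain, so no generator is swallowed by
  another.\<close>

lemma complex_facets_generated_complex:
  assumes "\<And>f. f \<in> \<F> \<Longrightarrow> card f = 4"
  shows "complex_facets (generated_complex \<F>) = \<F>"
proof -
  have fin: "finite f" if "f \<in> \<F>" for f using assms[OF that] by (auto intro: card_ge_0_finite)
  have "f = g" if "f \<in> \<F>" "g \<in> \<F>" "f \<subseteq> g" for f g
    using card_subset_eq[OF fin[OF that(2)] that(3)] assms that by auto
  then show ?thesis unfolding complex_facets_def generated_complex_def by blast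
qed

lemma ridges_generated_complex:
  "ridges (generated_complex \<F>) = {r. card r = 3 \<and> (\<exists>f\<in>\<F>. r \<subseteq> f)}"
  by (auto simp: ridges_def generated_complex_def)

lemma verts_facet_ridge_graph:
  assumes "\<And>f. f \<in> \<F> \<Longrightarrow> card f = 4"
  shows "verts (facet_ridge_graph (generated_complex \<F>)) = \<F>"
  using complex_facets_generated_complex[OF assms] by (simp add: facet_ridge_graph_def)

text \<open>Two distinct four-element sets meet in at most three elements, so a common ridge is
  their entire intersection. This turns adjacency into a count.\<close>

lemma card_Int_eq_3_iff:
  assumes "card f = 4" "card g = 4"
  shows "f \<noteq> g \<and> (\<exists>r. card r = 3 \<and> r \<subseteq> f \<and> r \<subseteq> g) \<longleftrightarrow> card (f \<inter> g) = 3"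
proof
  have fin: "finite f" "finite g" using assms by (auto intro: card_ge_0_finite)
  assume l: "f \<noteq> g \<and> (\<exists>r. card r = 3 \<and> r \<subseteq> f \<and> r \<subseteq> g)"
  then obtain r where r: "card r = 3" "r \<subseteq> f \<inter> g" by auto
  have "3 \<le> card (f \<inter> g)" using card_mono[OF _ r(2)] fin r(1) by auto
  moreover have "card (f \<inter> g) \<noteq> 4"
    using l assms fin card_subset_eq[OF fin(1), of "f \<inter> g"] card_subset_eq[OF fin(2), of "f \<inter> g"]
    by auto
  moreover have "card (f \<inter> g) \<le> 4" using card_mono[OF fin(1), of "f \<inter> g"] assms by auto
  ultimately show "card (f \<inter> g) = 3" by linarith
next
  assume "card (f \<inter> g) = 3"
  with assms show "f \<noteq> g \<and> (\<exists>r. card r = 3 \<and> r \<subseteq> f \<and> r \<subseteq> g)"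
    by (auto intro!: exI[of _ "f \<inter> g"])
qed

lemma arcs_ends_facet_ridge_graph:
  assumes "\<And>f. f \<in> \<F> \<Longrightarrow> card f = 4"
  shows "arcs_ends (facet_ridge_graph (generated_complex \<F>))
    = {(f, g). f \<in> \<F> \<and> g \<in> \<F> \<and> card (f \<inter> g) = 3}"
proof -
  have "arcs_ends (facet_ridge_graph (generated_complex \<F>))
     = {(f, g). f \<in> \<F> \<and> g \<in> \<F> \<and> f \<noteq> g \<and> (\<exists>r. card r = 3 \<and> r \<subseteq> f \<and> r \<subseteq> g)}"
    using complex_facets_generated_complex[OF assms]
    by (auto simp: facet_ridge_graph_def arcs_ends_conv ridges_generated_complex)
  also have "\<dots> = {(f, g). f \<in> \<F> \<and> g \<in> \<F> \<and> card (f \<inter> g) = 3}"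
    using card_Int_eq_3_iff assms by (intro Collect_cong) (auto split: prod.splits)
  finally show ?thesis .
qed

text \<open>Ridges of \<open>f\<close> correspond to the vertex they omit. The hypotheses say that
  exactly one vertex has no opposite facet, a condition that can be evaluated on words.\<close>

lemma unique_boundary_ridge:
  assumes card4: "\<And>f. f \<in> \<F> \<Longrightarrow> card f = 4" and f: "f \<in> \<F>"
    and v: "v \<in> f" "\<forall>g\<in>\<F>. \<not> (v \<notin> g \<and> f - {v} \<subseteq> g)"
    and others: "\<And>u. u \<in> f \<Longrightarrow> u \<noteq> v \<Longrightarrow> \<exists>g\<in>\<F>. u \<notin> g \<and> f - {u} \<subseteq> g"
  shows "\<exists>!r. boundary_ridge (generated_complex \<F>) r \<and> r \<subseteq> f"
proof -
  have fin: "finite f" using card4[OF f] by (auto intro: card_ge_0_finite)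
  have eq: "g = f" if "g \<in> \<F>" "f \<subseteq> g" for g
    using card4[OF f] card4[OF that(1)] card_subset_eq[of g f] that(2)
    by (metis card.infinite zero_neq_numeral)
  have cf: "complex_facets (generated_complex \<F>) = \<F>"
    using complex_facets_generated_complex card4 by blast
  \<comment> \<open>A facet containing both \<open>f - {v}\<close> and \<open>v\<close> contains
    \<open>f\<close> and so equals it; a second facet on this ridge is therefore one that misses
    \<open>v\<close>.\<close>
  have iff: "boundary_ridge (generated_complex \<F>) (f - {v})
      \<longleftrightarrow> (\<forall>g\<in>\<F>. \<not> (v \<notin> g \<and> f - {v} \<subseteq> g))" if v: "v \<in> f" for v
  proof -
    have "card (f - {v}) = 3" using fin v card4[OF f] by simp
    then have "boundary_ridge (generated_complex \<F>) (f - {v})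
      \<longleftrightarrow> (\<exists>!g. g \<in> \<F> \<and> f - {v} \<subseteq> g)"
      unfolding boundary_ridge_def cf ridges_generated_complex using f by blast
    also have "\<dots> \<longleftrightarrow> (\<forall>g\<in>\<F>. f - {v} \<subseteq> g \<longrightarrow> g = f)"
      using f by (metis Diff_subset)
    also have "\<dots> \<longleftrightarrow> (\<forall>g\<in>\<F>. \<not> (v \<notin> g \<and> f - {v} \<subseteq> g))"
      using v eq by blast
    finally show ?thesis .
  qed
  have rem: "\<exists>v\<in>f. r = f - {v}" if "boundary_ridge (generated_complex \<F>) r" "r \<subseteq> f" for r
  proof -
    have "card r = 3" using that(1) by (simp add: boundary_ridge_def ridges_def)
    then have "card (f - r) = 1" using card_Diff_subset[of r f] that(2) fin card4[OF f]
      by (simp add: finite_subset)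
    then obtain v where "f - r = {v}" by (auto simp: card_1_singleton_iff)
    then show ?thesis using that(2) by (intro bexI[of _ v]) auto
  qed
  show ?thesis
  proof (rule ex1I[of _ "f - {v}"])
    show "boundary_ridge (generated_complex \<F>) (f - {v}) \<and> f - {v} \<subseteq> f" 
      using iff[OF v(1), THEN iffD2, OF v(2)] Diff_subset by blast
  next
    fix r assume r: "boundary_ridge (generated_complex \<F>) r \<and> r \<subseteq> f"
    then obtain u where u: "u \<in> f" "r = f - {u}" using rem[of r] by blast
    with r have "boundary_ridge (generated_complex \<F>) (f - {u})" by simp
    then show "r = f - {v}" using others[OF u(1)] iff[OF u(1)] u(2) by blast
  qed
qed

section \<open>Connectedness from spanning orders\<close>

text \<open>A certificate of connectedness, read from the end of the list: each further element has
  a neighbour among those already present, as when a spanning tree is grown.\<close>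

fun attached :: "('a \<Rightarrow> 'a \<Rightarrow> bool) \<Rightarrow> 'a list \<Rightarrow> bool" where
  "attached r [] = True"
| "attached r (x # xs) = ((xs = [] \<or> (\<exists>y\<in>set xs. r y x)) \<and> attached r xs)"

lemma attached_rtrancl_on:
  assumes "attached r xs" "set xs \<subseteq> V" "sym R"
    and "\<And>x y. x \<in> set xs \<Longrightarrow> y \<in> set xs \<Longrightarrow> r x y \<Longrightarrow> (x, y) \<in> R"
    and "u \<in> set xs" "v \<in> set xs"
  shows "(u, v) \<in> rtrancl_on V R"
  using assms
proof (induction xs arbitrary: u v)
  case (Cons x xs)
  show ?case
  proof (cases "xs = []")
    case True
    with Cons.prems show ?thesis by auto
  next
    case False
    then obtain y where y: "y \<in> set xs" "r y x" using Cons.prems(1) by auto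
    have R: "(y, x) \<in> R" "(x, y) \<in> R"
      using Cons.prems(3,4) y by (auto dest: symD)
    have V: "x \<in> V" "y \<in> V" using Cons.prems(2) y(1) by auto
    \<comment> \<open>All walks are routed through the neighbour \<open>y\<close> of the new element
      \<open>x\<close>.\<close>
    have IH: "(a, b) \<in> rtrancl_on V R" if "a \<in> set xs" "b \<in> set xs" for a b
      using Cons.IH[OF _ _ Cons.prems(3)] Cons.prems(1,2,4) that by auto
    have to_y: "(a, y) \<in> rtrancl_on V R" if "a \<in> set (x # xs)" for a
      using that IH[OF _ y(1)] R V by (auto intro: converse_rtrancl_on_into_rtrancl_on)
    have from_y: "(y, a) \<in> rtrancl_on V R" if "a \<in> set (x # xs)" for a
      using that IH[OF y(1)] R V by (auto intro: rtrancl_on_into_rtrancl_on)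
    show ?thesis using rtrancl_on_trans[OF to_y from_y] Cons.prems(5,6) by blast
  qed
qed simp

lemma connected_attached:
  assumes "verts G = set xs" "xs \<noteq> []" "attached r xs"
    and "\<And>x y. x \<in> set xs \<Longrightarrow> y \<in> set xs \<Longrightarrow> r x y \<Longrightarrow> (x, y) \<in> arcs_ends G"
  shows "Digraph_Component.connected G"
proof -
  have "sym ((arcs_ends G)\<^sup>s)" by (auto simp: symcl_def intro!: symI)
  moreover have "(x, y) \<in> (arcs_ends G)\<^sup>s" if "x \<in> set xs" "y \<in> set xs" "r x y" for x y
    using assms(4)[OF that] by (simp add: symcl_def)
  ultimately have "(u, v) \<in> rtrancl_on (verts G) ((arcs_ends G)\<^sup>s)"
    if "u \<in> set xs" "v \<in> set xs" for u v
    using attached_rtrancl_on[OF assms(3)] assms(1) that by blast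
  then show ?thesis using assms(1,2) by (simp add: connected_conv)
qed

lemma attached_mono:
  assumes "attached r xs" "\<And>x y. x \<in> set xs \<Longrightarrow> y \<in> set xs \<Longrightarrow> r x y \<Longrightarrow> s x y"
  shows "attached s xs"
  using assms
proof (induction xs)
  case (Cons x xs)
  then have "attached s xs" by simp
  moreover have "xs = [] \<or> (\<exists>y\<in>set xs. s y x)" using Cons.prems by auto
  ultimately show ?case by simp
qed simp

lemma attached_map: "attached r (map f xs) \<longleftrightarrow> attached (\<lambda>x y. r (f x) (f y)) xs"
  by (induction xs) auto

section \<open>Straight-line drawings\<close>

text \<open>Twice the signed area of the triangle \<open>a b c\<close>; its sign tells the side of
  the line through \<open>a\<close> and \<open>b\<close> on which \<open>c\<close> lies.\<close>

definition orientation :: "real^2 \<Rightarrow> real^2 \<Rightarrow> real^2 \<Rightarrow> real" where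
  "orientation a b c = (b$1 - a$1) * (c$2 - a$2) - (b$2 - a$2) * (c$1 - a$1)"

lemma orientation_combination:
  "orientation a b ((1 - u) *\<^sub>R c + u *\<^sub>R d) = (1 - u) * orientation a b c + u * orientation a b d"
  by (simp add: orientation_def algebra_simps)

lemma orientation_self [simp]: "orientation a b a = 0" "orientation a b b = 0"
  by (simp_all add: orientation_def)

lemma orientation_closed_segment: "x \<in> closed_segment a b \<Longrightarrow> orientation a b x = 0"
  by (auto simp: in_segment orientation_combination)

text \<open>The orientation with respect to \<open>a\<close> and \<open>b\<close> is affine in its
  last argument. It vanishes on the first segment, and on the second it keeps the common strict sign
  of its end values.\<close>

lemma closed_segments_same_side:
  assumes "orientation a b c * orientation a b d > 0"
  shows "closed_segment a b \<inter> closed_segment c d = {}"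
proof -
  have False if x: "x \<in> closed_segment a b" "x \<in> closed_segment c d" for x
  proof -
    obtain u where u: "0 \<le> u" "u \<le> 1" "x = (1 - u) *\<^sub>R c + u *\<^sub>R d"
      using x(2) by (auto simp: in_segment)
    have z: "(1 - u) * orientation a b c + u * orientation a b d = 0"
      using orientation_closed_segment[OF x(1)] u(3) by (simp add: orientation_combination)
    \<comment> \<open>Multiplying by \<open>orientation a b c\<close> treats both signs at
      once.\<close>
    have "0 = orientation a b c * ((1 - u) * orientation a b c + u * orientation a b d)"
      using z by simp
    also have "\<dots> = (1 - u) * (orientation a b c)\<^sup>2 + u * (orientation a b c * orientation a b d)"
      by (simp add: algebra_simps power2_eq_square)
    also have "\<dots> > 0"
    proof (cases "u = 0")
      case True
      then show ?thesis using assms by auto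
    next
      case False
      with u assms have "u * (orientation a b c * orientation a b d) > 0"
        by (intro mult_pos_pos[of u]) auto
      with u(2) show ?thesis by (intro add_nonneg_pos) auto
    qed
    finally show False by simp
  qed
  then show ?thesis by blast
qed

text \<open>As \<open>c\<close> is off the line through \<open>a\<close> and \<open>b\<close>, the
  segment from \<open>a\<close> to \<open>c\<close> meets this line only at
  \<open>a\<close>.\<close>

lemma closed_segments_common_end:
  assumes "orientation a b c \<noteq> 0"
  shows "closed_segment a b \<inter> closed_segment a c \<subseteq> {a}"
proof
  fix x assume x: "x \<in> closed_segment a b \<inter> closed_segment a c"
  then obtain u where u: "x = (1 - u) *\<^sub>R a + u *\<^sub>R c" by (auto simp: in_segment)
  have "u * orientation a b c = 0"
    using orientation_closed_segment[of x a b] x u by (simp add: orientation_combination)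
  with u assms show "x \<in> {a}" by simp
qed

text \<open>By \<open>incident\<close> every vertex is an end of some edge. A vertex on a foreign
  edge would thus be a common point of two edges, so testing pairs of edges also keeps edges away
  from other vertices.\<close>

lemma planar_straight_line:
  fixes p :: "'v \<Rightarrow> real^2"
  assumes inj: "inj_on p (verts G)"
    and arcs: "\<And>u v. (u, v) \<in> arcs_ends G \<Longrightarrow> u \<in> verts G \<and> v \<in> verts G \<and> u \<noteq> v"
    and incident: "\<And>u. u \<in> verts G \<Longrightarrow> \<exists>v. (u, v) \<in> arcs_ends G"
    and cross: "\<And>u v x y. (u, v) \<in> arcs_ends G \<Longrightarrow> (x, y) \<in> arcs_ends G \<Longrightarrow> {u, v} \<noteq> {x, y} \<Longrightarrow>
      closed_segment (p u) (p v) \<inter> closed_segment (p x) (p y) \<subseteq> p ` ({u, v} \<inter> {x, y})"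
  shows "planar G"
proof -
  have "\<exists>u v. (u, v) \<in> arcs_ends G \<and> e = {u, v}" if "e \<in> undirected_edges G" for e
    using that by (auto simp: undirected_edges_def)
  \<comment> \<open>An undirected edge has no preferred direction; one is chosen so that it becomes
    a single linear path.\<close>
  then obtain s t where st: "\<And>e. e \<in> undirected_edges G \<Longrightarrow> (s e, t e) \<in> arcs_ends G"
    "\<And>e. e \<in> undirected_edges G \<Longrightarrow> e = {s e, t e}" by metis
  define \<gamma> where "\<gamma> e = linepath (p (s e)) (p (t e))" for e
  have img: "path_image (\<gamma> e) = closed_segment (p (s e)) (p (t e))" for e by (simp add: \<gamma>_def)
  have meet: "path_image (\<gamma> e) \<inter> path_image (\<gamma> e') \<subseteq> p ` (e \<inter> e')"
    if "e \<in> undirected_edges G" "e' \<in> undirected_edges G" "e \<noteq> e'" for e e'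
    using cross[OF st(1) st(1), of e e'] st(2)[of e] st(2)[of e'] that by (simp add: img)
  have "planar_drawing G p \<gamma>"
    unfolding planar_drawing_def
  proof (intro conjI ballI impI inj)
    fix e assume e: "e \<in> undirected_edges G"
    have V: "s e \<in> verts G" "t e \<in> verts G" "s e \<noteq> t e" using arcs[OF st(1)[OF e]] by auto
    have "p (s e) \<noteq> p (t e)" using V inj by (auto dest: inj_onD)
    then show "arc (\<gamma> e)" by (simp add: \<gamma>_def arc_linepath)
    have pe: "p ` e = {p (s e), p (t e)}"
      using arg_cong[OF st(2)[OF e], of "image p"] by simp
    then show "{pathstart (\<gamma> e), pathfinish (\<gamma> e)} = p ` e" by (simp add: \<gamma>_def)
    show "path_image (\<gamma> e) \<inter> p ` verts G = p ` e"
    proof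
      show "p ` e \<subseteq> path_image (\<gamma> e) \<inter> p ` verts G" using pe V by (auto simp: img)
      show "path_image (\<gamma> e) \<inter> p ` verts G \<subseteq> p ` e"
      proof
        fix q assume q: "q \<in> path_image (\<gamma> e) \<inter> p ` verts G"
        then obtain w where w: "w \<in> verts G" "q = p w" by blast
        obtain x where x: "(w, x) \<in> arcs_ends G" using incident[OF w(1)] by blast
        define e' where "e' = {w, x}"
        have e': "e' \<in> undirected_edges G" using x by (force simp: undirected_edges_def e'_def)
        have "q \<in> path_image (\<gamma> e')"
          using w(2) st(2)[OF e'] by (auto simp: img e'_def doubleton_eq_iff)
        then show "q \<in> p ` e" using meet[OF e e'] q w(2) pe
          by (cases "e = e'") (auto simp: e'_def)
      qed
    qed
  next
    fix e e' assume "e \<in> undirected_edges G" "e' \<in> undirected_edges G" "e \<noteq> e'"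
    then show "path_image (\<gamma> e) \<inter> path_image (\<gamma> e') \<subseteq> p ` (e \<inter> e')" by (rule meet)
  qed
  then show ?thesis unfolding planar_def by blast
qed

section \<open>Drawings on the integer grid\<close>

text \<open>For a list without repetitions each related pair is listed at most once, with the
  earlier entry first, which avoids comparing an edge with its own reverse.\<close>

fun edges_of :: "('a \<Rightarrow> 'a \<Rightarrow> bool) \<Rightarrow> 'a list \<Rightarrow> ('a \<times> 'a) list" where
  "edges_of r [] = []"
| "edges_of r (x # xs) = map (Pair x) (filter (r x) xs) @ edges_of r xs"

lemma edges_of_complete:
  assumes "x \<in> set xs" "y \<in> set xs" "x \<noteq> y" "r x y" "r y x"
  shows "(x, y) \<in> set (edges_of r xs) \<or> (y, x) \<in> set (edges_of r xs)"
  using assms by (induction xs) auto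

text \<open>Here \<open>sorted_wrt\<close> serves as a test of all pairs of entries, the earlier one
  first, and not as an ordering.\<close>

lemma sorted_wrt_cases:
  assumes "sorted_wrt r xs" "x \<in> set xs" "y \<in> set xs"
  shows "x = y \<or> r x y \<or> r y x"
  using assms by (induction xs) auto

fun int_point :: "int \<times> int \<Rightarrow> real^2" where
  "int_point (x, y) = vector [real_of_int x, real_of_int y]"

fun int_orientation :: "int \<times> int \<Rightarrow> int \<times> int \<Rightarrow> int \<times> int \<Rightarrow> int" where
  "int_orientation (a1, a2) (b1, b2) (c1, c2) = (b1 - a1) * (c2 - a2) - (b2 - a2) * (c1 - a1)"

lemma orientation_int_point:
  "orientation (int_point a) (int_point b) (int_point c) = real_of_int (int_orientation a b c)"
  by (cases a; cases b; cases c) (simp add: orientation_def)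

lemma inj_int_point: "inj int_point"
  by (rule injI) (auto simp: vec_eq_iff forall_2 elim!: int_point.elims)

text \<open>A sufficient test in integer arithmetic: segments with a common end must not be
  collinear; otherwise one of them must lie strictly on one side of the line through the
  other.\<close>

definition segments_compatible ::
  "int \<times> int \<Rightarrow> int \<times> int \<Rightarrow> int \<times> int \<Rightarrow> int \<times> int \<Rightarrow> bool" where
  "segments_compatible a b c d \<longleftrightarrow>
     (if a = c then int_orientation a b d \<noteq> 0
      else if a = d then int_orientation a b c \<noteq> 0
      else if b = c then int_orientation b a d \<noteq> 0
      else if b = d then int_orientation b a c \<noteq> 0
      else int_orientation a b c * int_orientation a b d > 0
        \<or> int_orientation c d a * int_orientation c d b > 0)"

lemma segments_compatible_Int:
  assumes "segments_compatible a b c d"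
  shows "closed_segment (int_point a) (int_point b) \<inter> closed_segment (int_point c) (int_point d)
    \<subseteq> int_point ` ({a, b} \<inter> {c, d})"
proof -
  have share: "closed_segment (int_point x) (int_point y) \<inter> closed_segment (int_point x) (int_point z)
    \<subseteq> {int_point x}" if "int_orientation x y z \<noteq> 0" for x y z
    using that by (intro closed_segments_common_end) (simp add: orientation_int_point)
  have disj: "closed_segment (int_point x) (int_point y) \<inter> closed_segment (int_point z) (int_point w) = {}"
    if "int_orientation x y z * int_orientation x y w > 0" for x y z w
    using that
    by (intro closed_segments_same_side) (simp add: orientation_int_point flip: of_int_mult)
  consider "a = c" | "a \<noteq> c" "a = d" | "a \<noteq> c" "a \<noteq> d" "b = c"
    | "a \<noteq> c" "a \<noteq> d" "b \<noteq> c" "b = d" | "a \<noteq> c" "a \<noteq> d" "b \<noteq> c" "b \<noteq> d" by blast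
  then show ?thesis
  proof cases
    case 1
    with share[of a b d] assms show ?thesis by (auto simp: segments_compatible_def)
  next
    case 2
    with share[of a b c] assms show ?thesis
      by (auto simp: segments_compatible_def closed_segment_commute)
  next
    case 3
    with share[of b a d] assms show ?thesis
      by (auto simp: segments_compatible_def closed_segment_commute)
  next
    case 4
    with share[of b a c] assms show ?thesis
      by (auto simp: segments_compatible_def closed_segment_commute)
  next
    case 5
    with disj[of a b c d] disj[of c d a b] assms show ?thesis
      by (auto simp: segments_compatible_def)
  qed
qed

text \<open>The graph lives on sets of points, while positions and crossing tests live on words;
  \<open>\<phi>\<close> translates, and \<open>r\<close> is an adjacency that can be
  evaluated.\<close>

lemma planar_int_drawing:
  fixes T :: "('w \<times> int \<times> int) list" and \<phi> :: "'w \<Rightarrow> 'v"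
  assumes verts: "verts G = \<phi> ` fst ` set T" and inj: "inj_on \<phi> (fst ` set T)"
    and dist: "distinct (map fst T)" "distinct (map snd T)"
    and arcs: "arcs_ends G \<subseteq> verts G \<times> verts G"
    and adj: "\<And>x y. x \<in> set T \<Longrightarrow> y \<in> set T \<Longrightarrow> (\<phi> (fst x), \<phi> (fst y)) \<in> arcs_ends G \<longleftrightarrow> r x y"
    and sym: "\<And>x y. x \<in> set T \<Longrightarrow> y \<in> set T \<Longrightarrow> r x y \<Longrightarrow> r y x"
    and irrefl: "\<And>x. x \<in> set T \<Longrightarrow> \<not> r x x"
    and incident: "\<And>x. x \<in> set T \<Longrightarrow> \<exists>y\<in>set T. r x y"
    and cross: "sorted_wrt (\<lambda>e e'. segments_compatible (snd (fst e)) (snd (snd e))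
      (snd (fst e')) (snd (snd e'))) (edges_of r T)"
  shows "planar G"
proof -
  \<comment> \<open>A vertex of the graph comes from one word, as \<open>\<phi>\<close> is
    injective, and a word has one position, as the keys are distinct.\<close>
  define pos where "pos U = (THE a. \<exists>w. (w, a) \<in> set T \<and> \<phi> w = U)" for U
  have pos: "pos (\<phi> (fst x)) = snd x" if "x \<in> set T" for x
    unfolding pos_def
  proof (rule the_equality)
    show "\<exists>w. (w, snd x) \<in> set T \<and> \<phi> w = \<phi> (fst x)" using that by (intro exI[of _ "fst x"]) simp
  next
    fix a assume "\<exists>w. (w, a) \<in> set T \<and> \<phi> w = \<phi> (fst x)"
    then obtain w where w: "(w, a) \<in> set T" "\<phi> w = \<phi> (fst x)" by blast
    have "w = fst x" using inj w that by (force dest: inj_onD)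
    with w(1) that dist(1) show "a = snd x"
      by (metis eq_key_imp_eq_value prod.collapse)
  qed
  have snd_inj: "x = y" if "x \<in> set T" "y \<in> set T" "snd x = snd y" for x y
    using that dist(2) by (auto simp: distinct_map dest: inj_onD)
  have arcE: "\<exists>x y. x \<in> set T \<and> y \<in> set T \<and> r x y \<and> U = \<phi> (fst x) \<and> W = \<phi> (fst y)"
    if "(U, W) \<in> arcs_ends G" for U W
  proof -
    have "U \<in> \<phi> ` fst ` set T" "W \<in> \<phi> ` fst ` set T" using that arcs verts by auto
    then obtain x y where "x \<in> set T" "y \<in> set T" "U = \<phi> (fst x)" "W = \<phi> (fst y)" by auto
    then show ?thesis using adj[of x y] that by blast
  qed
  have seg: "closed_segment (int_point (snd x)) (int_point (snd y)) \<inter>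
      closed_segment (int_point (snd x')) (int_point (snd y'))
      \<subseteq> int_point ` snd ` ({x, y} \<inter> {x', y'})"
    if "x \<in> set T" "y \<in> set T" "r x y" "x' \<in> set T" "y' \<in> set T" "r x' y'" "{x, y} \<noteq> {x', y'}"
    for x y x' y'
  proof -
    \<comment> \<open>The test compares two listed edges in one order only; symmetry of the
      intersection supplies the other.\<close>
    have *: "closed_segment (int_point (snd x)) (int_point (snd y)) \<inter>
        closed_segment (int_point (snd x')) (int_point (snd y'))
        \<subseteq> int_point ` ({snd x, snd y} \<inter> {snd x', snd y'})"
      if "(x, y) \<in> set (edges_of r T)" "(x', y') \<in> set (edges_of r T)" "{x, y} \<noteq> {x', y'}"
      for x y x' y'
    proof -
      have "(x, y) \<noteq> (x', y')" using that(3) by auto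
      then have "segments_compatible (snd x) (snd y) (snd x') (snd y')
        \<or> segments_compatible (snd x') (snd y') (snd x) (snd y)"
        using sorted_wrt_cases[OF cross that(1,2)] by auto
      then show ?thesis
        using segments_compatible_Int by (metis Int_commute)
    qed
    have "x \<noteq> y" "x' \<noteq> y'" using irrefl[of x] irrefl[of x'] that by metis+
    then have "(x, y) \<in> set (edges_of r T) \<or> (y, x) \<in> set (edges_of r T)"
      "(x', y') \<in> set (edges_of r T) \<or> (y', x') \<in> set (edges_of r T)"
      using edges_of_complete[of x T y r] edges_of_complete[of x' T y' r] sym that by blast+
    \<comment> \<open>Each of the two edges is listed in one of its two directions, which gives four
      combinations.\<close>
    then have "closed_segment (int_point (snd x)) (int_point (snd y)) \<inter>
        closed_segment (int_point (snd x')) (int_point (snd y'))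
        \<subseteq> int_point ` ({snd x, snd y} \<inter> {snd x', snd y'})"
      using *[of x y x' y'] *[of y x x' y'] *[of x y y' x'] *[of y x y' x'] that(7)
      by (elim disjE) (simp_all add: closed_segment_commute insert_commute)
    \<comment> \<open>Positions are distinct, so a common end point comes from a common
      vertex.\<close>
    moreover have "{snd x, snd y} \<inter> {snd x', snd y'} \<subseteq> snd ` ({x, y} \<inter> {x', y'})"
      using inj_on_image_Int[of snd "set T" "{x, y}" "{x', y'}"] that(1,2,4,5) dist(2)
      by (simp add: distinct_map)
    ultimately show ?thesis by (rule order_trans[OF _ image_mono])
  qed
  show ?thesis
  proof (rule planar_straight_line[of "int_point \<circ> pos"])
    show "inj_on (int_point \<circ> pos) (verts G)"
    proof (rule inj_onI)
      fix U W assume "U \<in> verts G" "W \<in> verts G" and eq: "(int_point \<circ> pos) U = (int_point \<circ> pos) W"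
      then obtain x y where "x \<in> set T" "U = \<phi> (fst x)" "y \<in> set T" "W = \<phi> (fst y)"
        using verts by auto
      moreover from this eq have "snd x = snd y" using injD[OF inj_int_point] pos by simp
      ultimately show "U = W" using snd_inj by blast
    qed
  next
    fix U W assume UW: "(U, W) \<in> arcs_ends G"
    obtain x y where x: "x \<in> set T" "y \<in> set T" "r x y" "U = \<phi> (fst x)" "W = \<phi> (fst y)"
      using arcE[OF UW] by blast
    have "x \<noteq> y" using irrefl[of x] x by metis
    then have "fst x \<noteq> fst y" using x dist(1) by (auto simp: distinct_map dest: inj_onD)
    then have "U \<noteq> W" using inj x by (auto dest: inj_onD)
    then show "U \<in> verts G \<and> W \<in> verts G \<and> U \<noteq> W" using UW arcs by auto
  next
    fix U assume "U \<in> verts G"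
    then obtain x where x: "x \<in> set T" "U = \<phi> (fst x)" using verts by auto
    obtain y where "y \<in> set T" "r x y" using incident[OF x(1)] by blast
    then show "\<exists>W. (U, W) \<in> arcs_ends G" using adj[OF x(1)] x(2) by blast
  next
    fix U W U' W' assume UW: "(U, W) \<in> arcs_ends G" and UW': "(U', W') \<in> arcs_ends G"
      and ne: "{U, W} \<noteq> {U', W'}"
    obtain x y where x: "x \<in> set T" "y \<in> set T" "r x y" and U: "U = \<phi> (fst x)" "W = \<phi> (fst y)"
      using arcE[OF UW] by blast
    obtain x' y' where x': "x' \<in> set T" "y' \<in> set T" "r x' y'" and U': "U' = \<phi> (fst x')" "W' = \<phi> (fst y')"
      using arcE[OF UW'] by blast
    have "{x, y} \<noteq> {x', y'}" using ne U U' by (auto simp: doubleton_eq_iff)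
    from seg[OF x x' this]
    have "closed_segment ((int_point \<circ> pos) U) ((int_point \<circ> pos) W) \<inter>
        closed_segment ((int_point \<circ> pos) U') ((int_point \<circ> pos) W')
        \<subseteq> int_point ` snd ` ({x, y} \<inter> {x', y'})"
      using pos x x' U U' by simp
    also have "\<dots> \<subseteq> (int_point \<circ> pos) ` ({U, W} \<inter> {U', W'})"
    proof
      fix q assume "q \<in> int_point ` snd ` ({x, y} \<inter> {x', y'})"
      then obtain z where z: "z \<in> {x, y}" "z \<in> {x', y'}" "q = int_point (snd z)" by blast
      have "\<phi> (fst z) \<in> {U, W} \<inter> {U', W'}" using z U U' by auto
      moreover have "q = (int_point \<circ> pos) (\<phi> (fst z))" using pos[of z] z x by auto
      ultimately show "q \<in> (int_point \<circ> pos) ` ({U, W} \<inter> {U', W'})" by blast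
    qed
    finally show "closed_segment ((int_point \<circ> pos) U) ((int_point \<circ> pos) W) \<inter>
        closed_segment ((int_point \<circ> pos) U') ((int_point \<circ> pos) W')
        \<subseteq> (int_point \<circ> pos) ` ({U, W} \<inter> {U', W'})" .
  qed
qed

section \<open>The twelve points\<close>

text \<open>Names for the points, so that incidences are evaluated on words instead of sets of real
  vectors.\<close>

datatype label = vA | vB | vC | vD | vE | vF | vG | vH | vI | vJ | vK | vL

fun coords :: "label \<Rightarrow> int \<times> int \<times> int \<times> int" where
  "coords vA = (27, -95, 120, 0)"
| "coords vB = (-50, -45, 101, -94)"
| "coords vC = (-9, -67, 126, -35)"
| "coords vD = (195, -145, 11, 125)"
| "coords vE = (-40, -10, 8, -65)"
| "coords vF = (232, -102, -21, 198)"
| "coords vG = (-63, -25, 94, -139)"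
| "coords vH = (-80, 45, -49, -65)"
| "coords vI = (-72, 4, 24, -90)"
| "coords vJ = (-30, 167, -154, 92)"
| "coords vK = (-43, 190, -199, 100)"
| "coords vL = (-67, 80, -61, -26)"

text \<open>The grid points come from rounding a Tutte embedding.\<close>

definition piece_drawing :: "(label list \<times> int \<times> int) list" where
  "piece_drawing = [
    ([vG, vH, vK, vL], -1, -1),
    ([vD, vG, vH, vK], 1, 1),
    ([vF, vG, vJ, vK], -3, 2),
    ([vE, vG, vH, vI], 3, -2),
    ([vG, vJ, vK, vL], -3, 0),
    ([vD, vF, vG, vK], -1, 3),
    ([vG, vH, vI, vL], 1, -3),
    ([vD, vE, vG, vH], 3, 0),
    ([vC, vD, vF, vG], 0, 6),
    ([vA, vC, vD, vF], -1, 8),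
    ([vA, vC, vF, vJ], -5, 6),
    ([vA, vF, vJ, vK], -5, 4),
    ([vA, vC, vJ, vK], -7, 3),
    ([vB, vC, vJ, vK], -8, -1),
    ([vB, vJ, vK, vL], -6, -2),
    ([vB, vD, vE, vG], 6, 2),
    ([vA, vB, vD, vE], 8, 1),
    ([vA, vB, vE, vI], 7, -3),
    ([vA, vE, vH, vI], 5, -4),
    ([vA, vB, vH, vI], 5, -6),
    ([vB, vC, vH, vI], 1, -8),
    ([vC, vH, vI, vL], 0, -6),
    ([vA, vC, vD, vG], 3, 7),
    ([vB, vC, vK, vL], -6, -5),
    ([vA, vB, vD, vG], 6, 5),
    ([vB, vC, vI, vL], -3, -7)]"

text \<open>An entry \<open>(f, n, c)\<close> stands for the facet with vertex word \<open>f\<close> on the hyperplane \<open>n \<bullet> x = c\<close>.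
  The first 26 words generate the piece, in the order of \<open>piece_drawing\<close>; the other 12 are ordered
  so that each of them but the last shares a ridge with a later one.\<close>

definition facet_inequalities :: "(label list \<times> (int \<times> int \<times> int \<times> int) \<times> int) list" where
  "facet_inequalities = [
    ([vG, vH, vK, vL], (1770, 4803, -470, -5045), 425490),
    ([vD, vG, vH, vK], (853900, 322751, -357624, -800223), 15749866),
    ([vF, vG, vJ, vK], (690478, 423339, -78093, -534346), 12849763),
    ([vE, vG, vH, vI], (-27297, -63561, -42175, -27646), 3187080),
    ([vG, vJ, vK, vL], (-2128, 3711, 2493, -104), 290087),
    ([vD, vF, vG, vK], (1202810, 488301, -453732, -1096169), 21732128),
    ([vG, vH, vI, vL], (-38952, 14769, 13940, 4019), 2836470),
    ([vD, vE, vG, vH], (35806, -15932, -40500, -54967), 1975935),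
    ([vC, vD, vF, vG], (656891, 350173, 455130, -339702), 39862340),
    ([vA, vC, vD, vF], (276691, 143623, 206582, -134284), 18616312),
    ([vA, vC, vF, vJ], (-110860, 580289, 819253, 718702), 40189685),
    ([vA, vF, vJ, vK], (-551540, -153137, 207945, 713707), 24609835),
    ([vA, vC, vJ, vK], (-246744, -39673, 93325, 238054), 8305847),
    ([vB, vC, vJ, vK], (-291535, 53605, 140598, 163005), 11042453),
    ([vB, vJ, vK, vL], (-61533, 11703, 29834, 34179), 2350423),
    ([vB, vD, vE, vG], (-279065, -788389, -391830, -208825), 29485475),
    ([vA, vB, vD, vE], (-483185, -783286, -332295, 46325), 21490775),
    ([vA, vB, vE, vI], (-11813, -14921, -5967, 2946), 382504),
    ([vA, vE, vH, vI], (-47315, -58895, -23625, 12462), 1482520),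
    ([vA, vB, vH, vI], (-7337, -7613, -2619, 2490), 210856),
    ([vB, vC, vH, vI], (-1183, -339, 155, 630), 30840),
    ([vC, vH, vI, vL], (-8479, -1462, 1705, 4663), 225890),
    ([vA, vC, vD, vG], (106739, 46797, 74778, -59532), 7409598),
    ([vB, vC, vK, vL], (-8687, 1251, 3911, 4846), 317542),
    ([vA, vB, vD, vG], (-46430, -314083, -61260, -116650), 21233075),
    ([vB, vC, vI, vL], (-129669, -19363, 28407, 70852), 3563804),
    ([vC, vH, vK, vL], (-139935, -26685, 26211, 78658), 3596866),
    ([vC, vF, vG, vJ], (2263777, 2980067, 2047659, -601983), 59035957),
    ([vB, vE, vG, vI], (-55537, -107273, -53607, -23294), 4379464),
    ([vB, vG, vI, vL], (-147851, 51827, 78009, 53612), 7899716),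
    ([vB, vG, vJ, vL], (-305107, 206233, 250278, 140869), 18011257),
    ([vB, vC, vG, vJ], (-131875, 141031, 162030, 75573), 9508523),
    ([vA, vD, vF, vK], (-3378020, -2579531, -637965, 2951941), 77293105),
    ([vA, vD, vE, vH], (-147860, -197693, -86995, 43787), 4349215),
    ([vA, vD, vH, vK], (-1173020, -1039411, -422965, 791949), 16316705),
    ([vA, vC, vH, vK], (-1371605, -665755, -19575, 874834), 23864390),
    ([vA, vB, vC, vH], (-133519, -86727, -12613, 65790), 3120492),
    ([vA, vB, vC, vG], (-3343, -15385, 9167, -7298), 2471354)]"

text \<open>A spanning order for \<open>attached\<close>, read from the end: it starts at the word
  GHKL, and every other word shares three letters with a word after it.\<close>

definition piece_order :: "label list list" where
  "piece_order = [[vG, vJ, vK, vL], [vG, vH, vI, vL], [vF, vG, vJ, vK], [vE, vG, vH, vI],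
    [vD, vF, vG, vK], [vC, vH, vI, vL], [vC, vD, vF, vG], [vB, vJ, vK, vL],
    [vB, vC, vK, vL], [vB, vC, vJ, vK], [vB, vC, vI, vL], [vB, vC, vH, vI],
    [vA, vF, vJ, vK], [vA, vE, vH, vI], [vA, vC, vJ, vK], [vA, vC, vF, vJ],
    [vA, vC, vD, vF], [vA, vC, vD, vG], [vA, vB, vH, vI], [vA, vB, vE, vI],
    [vA, vB, vD, vG], [vA, vB, vD, vE], [vB, vD, vE, vG], [vD, vE, vG, vH],
    [vD, vG, vH, vK], [vG, vH, vK, vL]]"

definition labels :: "label list" where
  "labels = [vA, vB, vC, vD, vE, vF, vG, vH, vI, vJ, vK, vL]"

fun dot4 :: "int \<times> int \<times> int \<times> int \<Rightarrow> int \<times> int \<times> int \<times> int \<Rightarrow> int" where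
  "dot4 (a, b, c, d) (x, y, z, w) = a * x + b * y + c * z + d * w"

text \<open>The condition \<open>opposite\<close> of the locale for words: \<open>g\<close> contains
  the ridge of \<open>f\<close> that omits \<open>v\<close>, and misses \<open>v\<close>.\<close>

definition opposite_word :: "label list \<Rightarrow> label \<Rightarrow> label list \<Rightarrow> bool" where
  "opposite_word f v g \<longleftrightarrow> v \<notin> set g \<and> (\<forall>u\<in>set f. u = v \<or> u \<in> set g)"

definition common_ridge :: "label list \<Rightarrow> label list \<Rightarrow> bool" where
  "common_ridge f g \<longleftrightarrow> length (filter (\<lambda>v. v \<in> set g) f) = 3"

definition facet_words :: "label list list" where
  "facet_words = map fst facet_inequalities"

definition piece_words :: "label list list" where
  "piece_words = map fst piece_drawing"

definition rest_words :: "label list list" where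
  "rest_words = drop 26 facet_words"

section \<open>Finite checks by evaluation\<close>

text \<open>The certificate for \<open>exposed\<close>: all 38 hyperplanes are tested at all twelve
  points.\<close>

lemma facet_inequalities_valid:
  "list_all (\<lambda>(f, n, c). list_all (\<lambda>v. dot4 n (coords v) \<le> c \<and> (dot4 n (coords v) = c \<longleftrightarrow> v \<in> set f))
    labels) facet_inequalities"
  by code_simp

lemma facet_words_length: "list_all (\<lambda>f. length f = 4 \<and> distinct f) facet_words"
  by code_simp

text \<open>This distinguishes the words as sets of letters, which is stronger than distinctness as
  lists and makes \<open>face_set\<close> injective on them.\<close>

lemma facet_words_distinct: "sorted_wrt (\<lambda>f g. \<exists>v\<in>set f. v \<notin> set g) facet_words"
  by code_simp

text \<open>The certificate for \<open>opposite\<close>: no ridge of the 38 words is a boundary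
  ridge, so no facet of the polytope has been missed.\<close>

lemma facet_words_closed:
  "list_all (\<lambda>f. list_all (\<lambda>v. list_ex (opposite_word f v) facet_words) f) facet_words"
  by code_simp

lemma facet_words_cover: "list_all (\<lambda>v. list_ex (\<lambda>f. v \<in> set f) facet_words) labels"
  by code_simp

lemma take_facet_words: "take 26 facet_words = piece_words"
  by code_simp

text \<open>The defining property of a Perles piece: each word has a single letter whose removal
  leaves a ridge in no other word of the piece.\<close>

lemma piece_words_boundary:
  "list_all (\<lambda>f. length (filter (\<lambda>v. \<not> list_ex (opposite_word f v) piece_words) f) = 1) piece_words"
  by code_simp

lemma piece_order_attached:
  "attached common_ridge piece_order"
  "list_all (\<lambda>f. f \<in> set piece_words) piece_order" "list_all (\<lambda>f. f \<in> set piece_order) piece_words"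
  by code_simp+

text \<open>The certificate that the piece is non-separating: the twelve facets outside it are
  connected through ridges.\<close>

lemma rest_words_attached: "attached common_ridge rest_words" "rest_words \<noteq> []"
  by code_simp+

lemma length_piece_words: "length piece_words = 26"
  by code_simp

lemma piece_drawing_injective: "distinct (map fst piece_drawing)" "distinct (map snd piece_drawing)"
  by code_simp+

lemma piece_drawing_incident:
  "list_all (\<lambda>x. list_ex (\<lambda>y. common_ridge (fst x) (fst y)) piece_drawing) piece_drawing"
  by code_simp

lemma piece_drawing_crossing_free:
  "sorted_wrt (\<lambda>e e'. segments_compatible (snd (fst e)) (snd (snd e)) (snd (fst e')) (snd (snd e')))
    (edges_of (\<lambda>x y. common_ridge (fst x) (fst y)) piece_drawing)"
  by code_simp

section \<open>From words to point sets\<close>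

lemma set_labels: "set labels = UNIV"
proof -
  have "v \<in> set labels" for v by (cases v) (simp_all add: labels_def)
  then show ?thesis by blast
qed

fun vec4 :: "int \<times> int \<times> int \<times> int \<Rightarrow> real^4" where
  "vec4 (a, b, c, d) = vector [real_of_int a, real_of_int b, real_of_int c, real_of_int d]"

lemma vec4_nth: "vec4 (a, b, c, d) $ 1 = a" "vec4 (a, b, c, d) $ 2 = b"
  "vec4 (a, b, c, d) $ 3 = c" "vec4 (a, b, c, d) $ 4 = d"
  by (simp_all add: vector_def)

lemma inner_vec4: "vec4 m \<bullet> vec4 n = real_of_int (dot4 m n)"
  by (cases m; cases n) (simp add: inner_vec_def sum_4 vec4_nth del: vec4.simps)

lemma inj_vec4: "inj vec4"
proof (rule injI)
  fix m n assume "vec4 m = vec4 n"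
  then show "m = n"
    by (cases m; cases n) (simp add: vec_eq_iff forall_4 vec4_nth del: vec4.simps)
qed

definition pt :: "label \<Rightarrow> real^4" where
  "pt v = vec4 (coords v)"

lemma inj_pt: "inj pt"
proof (rule injI)
  fix u v assume "pt u = pt v"
  then have "coords u = coords v" using injD[OF inj_vec4] by (simp add: pt_def)
  then show "u = v" by (cases u; cases v) simp_all
qed

definition face_set :: "label list \<Rightarrow> (real^4) set" where
  "face_set f = pt ` set f"

lemma face_set_opposite:
  "opposite_word f v g \<longleftrightarrow> pt v \<notin> face_set g \<and> face_set f - {pt v} \<subseteq> face_set g"
proof -
  have "face_set f - {pt v} = pt ` (set f - {v})"
    using image_set_diff[OF inj_pt, of "set f" "{v}"] by (simp add: face_set_def)
  then show ?thesis
    by (auto simp: opposite_word_def face_set_def inj_image_mem_iff[OF inj_pt] inj_image_subset_iff[OF inj_pt])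
qed

lemma face_set_common_ridge:
  assumes "distinct f"
  shows "card (face_set f \<inter> face_set g) = 3 \<longleftrightarrow> common_ridge f g"
proof -
  have "face_set f \<inter> face_set g = pt ` set (filter (\<lambda>v. v \<in> set g) f)"
    unfolding face_set_def image_Int[OF inj_pt, symmetric] by (rule arg_cong[of _ _ "image pt"]) auto
  then have "card (face_set f \<inter> face_set g) = card (set (filter (\<lambda>v. v \<in> set g) f))"
    using card_image[OF inj_on_subset[OF inj_pt subset_UNIV]] by simp
  also have "\<dots> = length (filter (\<lambda>v. v \<in> set g) f)"
    using assms by (intro distinct_card) simp
  finally show ?thesis by (simp add: common_ridge_def)
qed

lemma facet_wordD:
  assumes "f \<in> set facet_words"
  shows "distinct f" "card (face_set f) = 4"
  using assms facet_words_length card_image[OF inj_on_subset[OF inj_pt subset_UNIV], of "set f"]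
  by (auto simp: list_all_iff face_set_def distinct_card)

lemma inj_on_face_set: "inj_on face_set (set facet_words)"
proof (rule inj_onI)
  fix f g assume fg: "f \<in> set facet_words" "g \<in> set facet_words" "face_set f = face_set g"
  then have "set f = set g" using inj_image_eq_iff[OF inj_pt] by (simp add: face_set_def)
  then show "f = g" using sorted_wrt_cases[OF facet_words_distinct fg(1,2)] by auto
qed

lemma facet_words_split: "facet_words = piece_words @ rest_words"
  using append_take_drop_id[of 26 facet_words] by (simp add: rest_words_def take_facet_words)

lemma distinct_facet_words: "distinct facet_words"
  by code_simp

text \<open>From this point on the facets, the boundary complex and its homeomorphism with the
  sphere are available from the locale.\<close>

interpretation twelve_points: closed_facet_system "range pt" "face_set ` set facet_words"
proof
  show "finite (range pt)" by (metis List.finite_set finite_imageI set_labels)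
  show "face_set ` set facet_words \<noteq> {}"
    using rest_words_attached(2) by (simp add: facet_words_split)
  show "\<Union> (face_set ` set facet_words) = range pt"
  proof -
    have "\<exists>f\<in>set facet_words. v \<in> set f" for v
      using facet_words_cover set_labels by (auto simp: list_all_iff list_ex_iff)
    then show ?thesis by (auto simp: face_set_def inj_image_mem_iff[OF inj_pt])
  qed
next
  fix W assume "W \<in> face_set ` set facet_words"
  then obtain f where f: "f \<in> set facet_words" "W = face_set f" by blast
  show "card W = DIM(real^4)" using facet_wordD(2) f by simp
  obtain n c where nc: "(f, n, c) \<in> set facet_inequalities"
    using f(1) by (auto simp: facet_words_def)
  have valid: "dot4 n (coords v) \<le> c \<and> (dot4 n (coords v) = c \<longleftrightarrow> v \<in> set f)" for v
    using facet_inequalities_valid nc set_labels by (fastforce simp: list_all_iff)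
  have "vec4 n \<bullet> pt v \<le> c \<and> (vec4 n \<bullet> pt v = c \<longleftrightarrow> pt v \<in> W)" for v
    using valid[of v] by (simp add: f(2) face_set_def inj_image_mem_iff[OF inj_pt]) (simp add: pt_def inner_vec4)
  then show "\<exists>a b. \<forall>v\<in>range pt. a \<bullet> v \<le> b \<and> (a \<bullet> v = b \<longleftrightarrow> v \<in> W)"
    by (intro exI[of _ "vec4 n"] exI[of _ "real_of_int c"]) auto
  fix w assume "w \<in> W"
  then obtain v where v: "v \<in> set f" "w = pt v" using f(2) by (auto simp: face_set_def)
  obtain g where "g \<in> set facet_words" "opposite_word f v g"
    using facet_words_closed f(1) v(1) by (fastforce simp: list_all_iff list_ex_iff)
  then show "\<exists>W'\<in>face_set ` set facet_words. w \<notin> W' \<and> W - {w} \<subseteq> W'"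
    using f(2) v(2) by (auto simp: face_set_opposite)
qed

section \<open>The Perles piece\<close>

lemma face_set_words_card: "U \<in> face_set ` set facet_words \<Longrightarrow> card U = 4"
  using facet_wordD(2) by blast

lemma piece_subset: "set piece_words \<subseteq> set facet_words"
  by (simp add: facet_words_split)

lemma piece_card: "U \<in> face_set ` set piece_words \<Longrightarrow> card U = 4"
  using face_set_words_card piece_subset by blast

lemma piece_arcs:
  assumes "f \<in> set piece_words" "g \<in> set piece_words"
  shows "(face_set f, face_set g) \<in> arcs_ends (facet_ridge_graph (generated_complex (face_set ` set piece_words)))
    \<longleftrightarrow> common_ridge f g"
  using assms face_set_common_ridge facet_wordD(1) piece_subset
  by (simp add: arcs_ends_facet_ridge_graph[OF piece_card] subset_iff)

lemma piece_planar: "planar (facet_ridge_graph (generated_complex (face_set ` set piece_words)))"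
proof (rule planar_int_drawing[where T = piece_drawing and \<phi> = face_set
      and r = "\<lambda>x y. common_ridge (fst x) (fst y)"])
  have T: "fst ` set piece_drawing = set piece_words" by (simp add: piece_words_def)
  then have word: "fst x \<in> set piece_words" if "x \<in> set piece_drawing" for x
    using that by blast
  show "verts (facet_ridge_graph (generated_complex (face_set ` set piece_words)))
      = face_set ` fst ` set piece_drawing"
    by (simp only: T verts_facet_ridge_graph[OF piece_card])
  show "inj_on face_set (fst ` set piece_drawing)"
    unfolding T using inj_on_face_set piece_subset by (rule inj_on_subset)
  show "arcs_ends (facet_ridge_graph (generated_complex (face_set ` set piece_words)))
    \<subseteq> verts (facet_ridge_graph (generated_complex (face_set ` set piece_words))) \<times>
       verts (facet_ridge_graph (generated_complex (face_set ` set piece_words)))"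
    using arcs_ends_facet_ridge_graph[OF piece_card] verts_facet_ridge_graph[OF piece_card] by auto
  show "(face_set (fst x), face_set (fst y))
      \<in> arcs_ends (facet_ridge_graph (generated_complex (face_set ` set piece_words)))
    \<longleftrightarrow> common_ridge (fst x) (fst y)"
    if "x \<in> set piece_drawing" "y \<in> set piece_drawing" for x y
    using piece_arcs word that by blast
  \<comment> \<open>\<open>common_ridge\<close> counts letters of its first argument; for words
    without repetition this is the size of the intersection, which is symmetric.\<close>
  show "common_ridge (fst y) (fst x)"
    if "x \<in> set piece_drawing" "y \<in> set piece_drawing" "common_ridge (fst x) (fst y)" for x y
  proof -
    have "distinct (fst x)" "distinct (fst y)" using word that facet_wordD(1) piece_subset by blast+
    then show ?thesis using that(3) by (metis face_set_common_ridge Int_commute)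
  qed
  show "\<not> common_ridge (fst x) (fst x)" if "x \<in> set piece_drawing" for x
  proof -
    have w: "fst x \<in> set facet_words" using word[OF that] piece_subset by blast
    show ?thesis using face_set_common_ridge[OF facet_wordD(1)[OF w], of "fst x"] facet_wordD(2)[OF w] by simp
  qed
  show "\<exists>y\<in>set piece_drawing. common_ridge (fst x) (fst y)" if "x \<in> set piece_drawing" for x
    using piece_drawing_incident that by (simp add: list_all_iff list_ex_iff)
qed (fact piece_drawing_injective piece_drawing_crossing_free)+

lemma piece_connected:
  "Digraph_Component.connected (facet_ridge_graph (generated_complex (face_set ` set piece_words)))"
proof -
  have set_order: "set piece_order = set piece_words"
    using piece_order_attached(2,3) by (auto simp: list_all_iff)
  then have nonempty: "piece_order \<noteq> []" using length_piece_words by auto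
  define r where "r U W \<longleftrightarrow> (U, W) \<in>
    arcs_ends (facet_ridge_graph (generated_complex (face_set ` set piece_words)))" for U W
  have "attached (\<lambda>f g. r (face_set f) (face_set g)) piece_order"
    unfolding r_def using set_order piece_arcs
    by (intro attached_mono[OF piece_order_attached(1)]) blast
  then have "attached r (map face_set piece_order)" by (simp add: attached_map)
  then show ?thesis
    by (rule connected_attached[rotated 2])
      (simp_all add: r_def set_order nonempty verts_facet_ridge_graph[OF piece_card])
qed

lemma rest_connected:
  "Digraph_Component.connected (facet_ridge_graph (generated_complex (face_set ` set facet_words))
    \<restriction> (face_set ` set rest_words))" (is "Digraph_Component.connected (?G \<restriction> ?R)")
proof -
  have arcs: "(face_set f, face_set g) \<in> arcs_ends (?G \<restriction> ?R)"
    if "f \<in> set rest_words" "g \<in> set rest_words" "common_ridge f g" for f g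
  proof -
    have fg: "f \<in> set facet_words" "g \<in> set facet_words" using that by (auto simp: facet_words_split)
    \<comment> \<open>Adjacency is that of the whole boundary complex; restriction to the remaining
      facets keeps the arcs between them.\<close>
    have "(face_set f, face_set g) \<in> arcs_ends ?G"
      using that(3) face_set_common_ridge[OF facet_wordD(1)[OF fg(1)]] fg
      by (simp add: arcs_ends_facet_ridge_graph[OF face_set_words_card])
    with that(1,2) show ?thesis by (auto simp: arcs_ends_conv)
  qed
  define r where "r U W \<longleftrightarrow> (U, W) \<in> arcs_ends (?G \<restriction> ?R)" for U W
  have "attached (\<lambda>f g. r (face_set f) (face_set g)) rest_words"
    unfolding r_def by (rule attached_mono[OF rest_words_attached(1)]) (rule arcs)
  then have "attached r (map face_set rest_words)" by (simp add: attached_map)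
  then show ?thesis
    by (rule connected_attached[rotated 2]) (simp_all add: r_def rest_words_attached(2))
qed

lemma piece_unique_boundary_ridge:
  assumes "U \<in> face_set ` set piece_words"
  shows "\<exists>!r. boundary_ridge (generated_complex (face_set ` set piece_words)) r \<and> r \<subseteq> U"
proof -
  obtain f where f: "f \<in> set piece_words" "U = face_set f" using assms by blast
  have "length (filter (\<lambda>v. \<not> list_ex (opposite_word f v) piece_words) f) = 1"
    using piece_words_boundary f(1) by (simp add: list_all_iff)
  then obtain v where "filter (\<lambda>v. \<not> list_ex (opposite_word f v) piece_words) f = [v]"
    by (auto simp: length_Suc_conv)
  then have "{v \<in> set f. \<not> list_ex (opposite_word f v) piece_words} = {v}"
    by (metis list.set(1) list.simps(15) set_filter)
  then have v: "v \<in> set f" "\<not> list_ex (opposite_word f v) piece_words"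
    and uniq: "\<And>u. u \<in> set f \<Longrightarrow> u \<noteq> v \<Longrightarrow> list_ex (opposite_word f u) piece_words" by blast+
  show ?thesis
  proof (rule unique_boundary_ridge[OF piece_card assms])
    show "pt v \<in> U" using v(1) f(2) by (simp add: face_set_def)
    show "\<forall>g\<in>face_set ` set piece_words. \<not> (pt v \<notin> g \<and> U - {pt v} \<subseteq> g)"
      using v(2) f(2) by (auto simp: list_ex_iff face_set_opposite)
    show "\<exists>g\<in>face_set ` set piece_words. u \<notin> g \<and> U - {u} \<subseteq> g" if u: "u \<in> U" "u \<noteq> pt v" for u
    proof -
      obtain u' where u': "u' \<in> set f" "u = pt u'" using u(1) f(2) by (auto simp: face_set_def)
      then show ?thesis using uniq[of u'] u(2) f(2) by (auto simp: list_ex_iff face_set_opposite)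
    qed
  qed
qed

text \<open>All generators of a star contain its apex, while two words of the piece have no letter
  in common.\<close>

lemma piece_not_star:
  "generated_complex (face_set ` set piece_words)
    \<noteq> star (generated_complex (face_set ` set facet_words)) x"
proof
  assume eq: "generated_complex (face_set ` set piece_words)
    = star (generated_complex (face_set ` set facet_words)) x"
  have cf: "complex_facets (generated_complex (face_set ` set facet_words)) = face_set ` set facet_words"
    by (rule complex_facets_generated_complex[OF face_set_words_card])
  have mem: "x \<in> face_set f" if f: "f \<in> set piece_words" for f
  proof -
    have "face_set f \<in> generated_complex (face_set ` set piece_words)"
      using f by (auto simp: generated_complex_def)
    then obtain g where g: "g \<in> face_set ` set facet_words" "x \<in> g" "face_set f \<subseteq> g"
      unfolding eq star_def cf by (auto simp: generated_complex_def)
    \<comment> \<open>A generator of the piece lies in a facet through \<open>x\<close>; equal size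
      makes it that facet.\<close>
    have "card (face_set f) = card g" using face_set_words_card[OF g(1)] piece_card f by simp
    then have "face_set f = g"
      using card_subset_eq[OF twelve_points.finite_W[OF g(1)] g(3)] by simp
    with g(2) show ?thesis by simp
  qed
  \<comment> \<open>The disjoint pair: GHKL and ACDF.\<close>
  have "[vG, vH, vK, vL] \<in> set piece_words" "[vA, vC, vD, vF] \<in> set piece_words"
    by (simp_all add: piece_words_def piece_drawing_def)
  from this[THEN mem] inj_pt show False by (auto simp: face_set_def dest: injD)
qed

lemma piece_non_separating:
  "non_separating_perles_piece (boundary_complex (convex hull range pt))
    (generated_complex (face_set ` set piece_words))"
proof -
  let ?\<Delta> = "generated_complex (face_set ` set facet_words)"
  let ?\<F> = "face_set ` set piece_words"
  have "finite (generated_complex (face_set ` set facet_words))"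
    "\<forall>s\<in>generated_complex (face_set ` set facet_words). finite s"
    unfolding generated_complex_def
    by (auto simp: face_set_def intro: finite_subset)
  then have "Defs.simplicial_complex ?\<Delta>"
    unfolding Defs.simplicial_complex_def generated_complex_def by blast
  then have "simplicial_3_sphere ?\<Delta>"
    using twelve_points.realization_homeomorphic_sphere by (simp add: simplicial_3_sphere_def)
  moreover have "?\<F> \<subseteq> complex_facets ?\<Delta>"
    using complex_facets_generated_complex[OF face_set_words_card] piece_subset by auto
  ultimately have "generates_perles_piece ?\<Delta> ?\<F>"
    unfolding generates_perles_piece_def
    by (intro conjI ballI piece_connected piece_unique_boundary_ridge)
  \<comment> \<open>Injectivity of \<open>face_set\<close> turns the difference of families of sets
    into the difference of lists of words, leaving the last twelve.\<close>
  moreover have "verts (facet_ridge_graph ?\<Delta>) - ?\<F> = face_set ` set rest_words"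
  proof -
    have "face_set ` set facet_words - ?\<F> = face_set ` (set facet_words - set piece_words)"
      using inj_on_image_set_diff[OF inj_on_face_set _ piece_subset, of "set facet_words"] by auto
    moreover have "set facet_words - set piece_words = set rest_words"
      using distinct_facet_words by (auto simp: facet_words_split)
    ultimately show ?thesis using verts_facet_ridge_graph[OF face_set_words_card] by simp
  qed
  ultimately show ?thesis
    unfolding non_separating_perles_piece_def twelve_points.boundary_complex_eq
    using rest_connected by (intro exI[of _ ?\<F>]) simp
qed

lemma facet_of_piece:
  assumes "W \<in> face_set ` set piece_words"
  shows "\<exists>Q. Q facet_of convex hull range pt \<and> polytope_vertices Q = W"
proof -
  have W: "W \<in> face_set ` set facet_words" using assms piece_subset by blast
  then show ?thesis
    using twelve_points.facet[OF W] twelve_points.vertices_subset[OF W order_refl] by blast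
qed

lemma card_range_pt: "card (range pt) = 12"
proof -
  have "card (range pt) = card (set labels)"
    using card_image[OF inj_pt] by (simp add: set_labels)
  then show ?thesis by (simp add: labels_def)
qed

lemma card_piece: "card (face_set ` set piece_words) = 26"
proof -
  have "card (face_set ` set piece_words) = card (set piece_words)"
    using card_image inj_on_subset[OF inj_on_face_set piece_subset] by blast
  also have "\<dots> = length piece_words"
    using distinct_facet_words by (intro distinct_card) (simp add: facet_words_split)
  finally show ?thesis by (simp add: length_piece_words)
qed

theorem proposition6p4:
  fixes A B C D E F G H I J K L :: "real^4" and P :: "(real^4) set" and \<F> :: "(real^4) set set"
  assumes "A = vector [27, -95, 120, 0]"
    and "B = vector [-50, -45, 101, -94]"
    and "C = vector [-9, -67, 126, -35]"
    and "D = vector [195, -145, 11, 125]"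
    and "E = vector [-40, -10, 8, -65]"
    and "F = vector [232, -102, -21, 198]"
    and "G = vector [-63, -25, 94, -139]"
    and "H = vector [-80, 45, -49, -65]"
    and "I = vector [-72, 4, 24, -90]"
    and "J = vector [-30, 167, -154, 92]"
    and "K = vector [-43, 190, -199, 100]"
    and "L = vector [-67, 80, -61, -26]"
    and "P = convex hull {A, B, C, D, E, F, G, H, I, J, K, L}"
    and "\<F> = {{G,H,K,L}, {D,G,H,K}, {F,G,J,K}, {E,G,H,I}, {G,J,K,L}, {D,F,G,K}, {G,H,I,L},
               {D,E,G,H}, {C,D,F,G}, {A,C,D,F}, {A,C,F,J}, {A,F,J,K}, {A,C,J,K}, {B,C,J,K},
               {B,J,K,L}, {B,D,E,G}, {A,B,D,E}, {A,B,E,I}, {A,E,H,I}, {A,B,H,I}, {B,C,H,I},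
               {C,H,I,L}, {A,C,D,G}, {B,C,K,L}, {A,B,D,G}, {B,C,I,L}}"
  shows "simplicial_polytope 4 P
    \<and> polytope_vertices P = {A, B, C, D, E, F, G, H, I, J, K, L}
    \<and> card {A, B, C, D, E, F, G, H, I, J, K, L} = 12
    \<and> card \<F> = 26
    \<and> (\<forall>W\<in>\<F>. card W = 4 \<and> (\<exists>Q. Q facet_of P \<and> polytope_vertices Q = W))
    \<and> non_separating_perles_piece (boundary_complex P) (generated_complex \<F>)
    \<and> verts (facet_ridge_graph (generated_complex \<F>)) = \<F>
    \<and> (\<forall>U\<in>\<F>. \<forall>V\<in>\<F>. U \<rightarrow>\<^bsub>facet_ridge_graph (generated_complex \<F>)\<^esub> V \<longleftrightarrow> card (U \<inter> V) = 3)
    \<and> planar (facet_ridge_graph (generated_complex \<F>))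
    \<and> \<not> (\<exists>v \<in> \<Union>(boundary_complex P). generated_complex \<F> = star (boundary_complex P) v)"
proof -
  have pt: "A = pt vA" "B = pt vB" "C = pt vC" "D = pt vD" "E = pt vE" "F = pt vF"
    "G = pt vG" "H = pt vH" "I = pt vI" "J = pt vJ" "K = pt vK" "L = pt vL"
    using assms(1-12) by (simp_all add: pt_def)
  \<comment> \<open>The twelve labels exhaust their type, so the given points are the full range of
    \<open>pt\<close>.\<close>
  have V: "{A, B, C, D, E, F, G, H, I, J, K, L} = range pt"
    unfolding pt set_labels[symmetric] by (simp add: labels_def)
  have \<F>: "\<F> = face_set ` set piece_words"
    unfolding assms(14) pt by (simp add: piece_words_def piece_drawing_def face_set_def)
  have P: "P = convex hull range pt" using assms(13) V by simp
  show ?thesis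
  proof (intro conjI)
    show "simplicial_polytope 4 P" using twelve_points.simplicial by (simp add: P)
    show "polytope_vertices P = {A, B, C, D, E, F, G, H, I, J, K, L}"
      unfolding V P by (rule twelve_points.vertices_hull)
    show "card {A, B, C, D, E, F, G, H, I, J, K, L} = 12" unfolding V by (rule card_range_pt)
    show "card \<F> = 26" unfolding \<F> by (rule card_piece)
    show "\<forall>W\<in>\<F>. card W = 4 \<and> (\<exists>Q. Q facet_of P \<and> polytope_vertices Q = W)"
      unfolding \<F> P using piece_card facet_of_piece by blast
    show "non_separating_perles_piece (boundary_complex P) (generated_complex \<F>)"
      unfolding \<F> P by (rule piece_non_separating)
    show "verts (facet_ridge_graph (generated_complex \<F>)) = \<F>"
      unfolding \<F> by (rule verts_facet_ridge_graph[OF piece_card])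
    show "\<forall>U\<in>\<F>. \<forall>V\<in>\<F>. U \<rightarrow>\<^bsub>facet_ridge_graph (generated_complex \<F>)\<^esub> V \<longleftrightarrow> card (U \<inter> V) = 3"
      unfolding \<F> by (simp add: arcs_ends_facet_ridge_graph[OF piece_card])
    show "planar (facet_ridge_graph (generated_complex \<F>))"
      unfolding \<F> by (rule piece_planar)
    show "\<not> (\<exists>v\<in>\<Union>(boundary_complex P). generated_complex \<F> = star (boundary_complex P) v)"
      unfolding \<F> P twelve_points.boundary_complex_eq using piece_not_star by blast
  qed
qed

end
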